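(* Convergent covers with convergent cover maps form a subcategory $\mathbf{CBCov}$ of $\mathbf{BCov}$. The category $\mathbf{CBCov}$ is (impredicatively) dual to, i.e. equivalent to the opposite of, the category $\mathbf{cQu}$ of commutative quantales.
   Context: A basic cover $(S,\lhd)$ on a set $S$ is a relation $\lhd$ between elements and subsets of $S$ such that $a\in U$ implies $a\lhd U$, and $a\lhd U$, $U\lhd V$ imply $a\lhd V$, where $U\lhd V$ means $b\lhd V$ for all $b\in U$. Put $\mathcal A U=\{a\in S\mid a\lhd U\}$; $U=_{\mathcal A}V$ means $\mathcal A U=\mathcal A V$. $Sat(\mathcal A)=\{U\subseteq S\mid U=\mathcal A U\}$ has joins $\bigvee^{\mathcal A}_i\mathcal A U_i=\mathcal A(\bigcup_iU_i)$. Elements are identified with singletons. For a relation $r$ between $S$ and $T$ and $V\subseteq T$, $r^-V=\{a\in S\mid\exists b\in V,\ a\,r\,b\}$. A basic cover map $r:(S,\lhd_S)\to(T,\lhd_T)$ is a relation between $S$ and $T$ such that $b\lhd_TV$ implies $r^-b\lhd_Sr^-V$; two are equal if $r_1^-b=_{\mathcal A_S}r_2^-b$ for all $b\in T$. $\mathbf{BCov}$ is the resulting category, with relational composition and identity relations. A convergent cover is $(S,\lhd,\circ)$ where $\lhd$ is a basic cover on $S$ and $\circ$ is a binary operation on $\mathcal P(S)$ such that: $U_1\lhd V_1$ and $U_2\lhd V_2$ imply $U_1\circ U_2\lhd V_1\circ V_2$; $(U\circ V)\circ W\lhd U\circ(V\circ W)$; $U\circ V\lhd V\circ U$; and the (well-defined)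 operation $\mathcal A U\circ^{\mathcal A}\mathcal A V=\mathcal A(U\circ V)$ on $Sat(\mathcal A)$ distributes over arbitrary joins. Write $a\circ b=\{a\}\circ\{b\}$. A convergent cover map $r:(S,\lhd_S,\circ_S)\to(T,\lhd_T,\circ_T)$ is a basic cover map with $r^-(b_1\circ_Tb_2)=_{\mathcal A_S}(r^-b_1)\circ_S(r^-b_2)$ for all $b_1,b_2\in T$; equality is equality of basic cover maps. A commutative quantale is a suplattice with an associative commutative binary operation (no unit required) distributing over arbitrary joins; morphisms in $\mathbf{cQu}$ are maps preserving arbitrary joins and multiplication. "Impredicatively" means in a foundation where powersets of sets are sets. *)

theory Defs
  imports "HOL-Algebra.Lattice" "HOL-Library.FuncSet" "HOL-Library.Equipollence"
begin

section \<open>Categories\<close>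

text \<open>
  Hom-sets need not be disjoint, so composition and functors take the objects as arguments.
  \<open>Comp C X Y Z g f\<close> is the composite of \<open>f\<close> from \<open>X\<close> to \<open>Y\<close> and \<open>g\<close> from \<open>Y\<close> to \<open>Z\<close>.
\<close>

record ('o, 'm) precat =
  Obj :: "'o set"
  Hom :: "'o \<Rightarrow> 'o \<Rightarrow> 'm set"
  Ident :: "'o \<Rightarrow> 'm"
  Comp :: "'o \<Rightarrow> 'o \<Rightarrow> 'o \<Rightarrow> 'm \<Rightarrow> 'm \<Rightarrow> 'm"

locale category =
  fixes C :: "('o, 'm) precat"
  assumes ident_in: "X \<in> Obj C \<Longrightarrow> Ident C X \<in> Hom C X X"
    and comp_in: "\<lbrakk>X \<in> Obj C; Y \<in> Obj C; Z \<in> Obj C; f \<in> Hom C X Y; g \<in> Hom C Y Z\<rbrakk>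
      \<Longrightarrow> Comp C X Y Z g f \<in> Hom C X Z"
    and comp_ident: "\<lbrakk>X \<in> Obj C; Y \<in> Obj C; f \<in> Hom C X Y\<rbrakk>
      \<Longrightarrow> Comp C X X Y f (Ident C X) = f"
    and ident_comp: "\<lbrakk>X \<in> Obj C; Y \<in> Obj C; f \<in> Hom C X Y\<rbrakk>
      \<Longrightarrow> Comp C X Y Y (Ident C Y) f = f"
    and comp_assoc: "\<lbrakk>W \<in> Obj C; X \<in> Obj C; Y \<in> Obj C; Z \<in> Obj C;
        f \<in> Hom C W X; g \<in> Hom C X Y; h \<in> Hom C Y Z\<rbrakk>
      \<Longrightarrow> Comp C W X Z (Comp C X Y Z h g) f = Comp C W Y Z h (Comp C W X Y g f)"

definition opposite :: "('o, 'm) precat \<Rightarrow> ('o, 'm) precat" where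
  "opposite C = \<lparr>Obj = Obj C, Hom = (\<lambda>X Y. Hom C Y X), Ident = Ident C,
     Comp = (\<lambda>X Y Z g f. Comp C Z Y X f g)\<rparr>"

definition isos :: "('o, 'm) precat \<Rightarrow> 'o \<Rightarrow> 'o \<Rightarrow> 'm set" where
  "isos C X Y = {f \<in> Hom C X Y. \<exists>g \<in> Hom C Y X.
     Comp C X Y X g f = Ident C X \<and> Comp C Y X Y f g = Ident C Y}"

record ('o, 'm, 'p, 'n) prefunctor =
  on_obj :: "'o \<Rightarrow> 'p"
  on_hom :: "'o \<Rightarrow> 'o \<Rightarrow> 'm \<Rightarrow> 'n"

locale cat_functor = dom: category C + cod: category D
  for C :: "('o, 'm) precat" and D :: "('p, 'n) precat" +
  fixes F :: "('o, 'm, 'p, 'n) prefunctor"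
  assumes on_obj_in: "X \<in> Obj C \<Longrightarrow> on_obj F X \<in> Obj D"
    and on_hom_in: "\<lbrakk>X \<in> Obj C; Y \<in> Obj C; f \<in> Hom C X Y\<rbrakk>
      \<Longrightarrow> on_hom F X Y f \<in> Hom D (on_obj F X) (on_obj F Y)"
    and on_hom_ident: "X \<in> Obj C \<Longrightarrow> on_hom F X X (Ident C X) = Ident D (on_obj F X)"
    and on_hom_comp: "\<lbrakk>X \<in> Obj C; Y \<in> Obj C; Z \<in> Obj C; f \<in> Hom C X Y; g \<in> Hom C Y Z\<rbrakk>
      \<Longrightarrow> on_hom F X Z (Comp C X Y Z g f) =
          Comp D (on_obj F X) (on_obj F Y) (on_obj F Z) (on_hom F Y Z g) (on_hom F X Y f)"

definition id_functor :: "('o, 'm, 'o, 'm) prefunctor" where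
  "id_functor = \<lparr>on_obj = (\<lambda>X. X), on_hom = (\<lambda>X Y f. f)\<rparr>"

definition comp_functor ::
  "('p, 'n, 'q, 'k) prefunctor \<Rightarrow> ('o, 'm, 'p, 'n) prefunctor \<Rightarrow> ('o, 'm, 'q, 'k) prefunctor" where
  "comp_functor G F = \<lparr>on_obj = (\<lambda>X. on_obj G (on_obj F X)),
     on_hom = (\<lambda>X Y f. on_hom G (on_obj F X) (on_obj F Y) (on_hom F X Y f))\<rparr>"

definition naturally_isomorphic ::
  "('o, 'm) precat \<Rightarrow> ('p, 'n) precat \<Rightarrow>
   ('o, 'm, 'p, 'n) prefunctor \<Rightarrow> ('o, 'm, 'p, 'n) prefunctor \<Rightarrow> bool" where
  "naturally_isomorphic C D F G \<longleftrightarrow>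
     (\<exists>\<eta>. (\<forall>X \<in> Obj C. \<eta> X \<in> isos D (on_obj F X) (on_obj G X)) \<and>
          (\<forall>X \<in> Obj C. \<forall>Y \<in> Obj C. \<forall>f \<in> Hom C X Y.
             Comp D (on_obj F X) (on_obj F Y) (on_obj G Y) (\<eta> Y) (on_hom F X Y f) =
             Comp D (on_obj F X) (on_obj G X) (on_obj G Y) (on_hom G X Y f) (\<eta> X)))"

definition equivalent_categories :: "('o, 'm) precat \<Rightarrow> ('p, 'n) precat \<Rightarrow> bool" where
  "equivalent_categories C D \<longleftrightarrow>
     (\<exists>F G. cat_functor C D F \<and> cat_functor D C G \<and>
            naturally_isomorphic C C (comp_functor G F) id_functor \<and>
            naturally_isomorphic D D (comp_functor F G) id_functor)"

definition full_and_faithful ::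
  "('o, 'm) precat \<Rightarrow> ('p, 'n) precat \<Rightarrow> ('o, 'm, 'p, 'n) prefunctor \<Rightarrow> bool" where
  "full_and_faithful C D F \<longleftrightarrow>
     (\<forall>X \<in> Obj C. \<forall>Y \<in> Obj C.
        bij_betw (on_hom F X Y) (Hom C X Y) (Hom D (on_obj F X) (on_obj F Y)))"

text \<open>
  A subcategory whose objects carry additional structure, discarded by \<open>u\<close>: the hom-sets of
  \<open>D\<close> are literally subsets of those of \<open>C\<close>, with the identities and composition of \<open>C\<close>.
\<close>

definition subcategory_along :: "('o \<Rightarrow> 'p) \<Rightarrow> ('o, 'm) precat \<Rightarrow> ('p, 'm) precat \<Rightarrow> bool" where
  "subcategory_along u D C \<longleftrightarrow>
     category D \<and> category C \<and>
     (\<forall>X \<in> Obj D. u X \<in> Obj C \<and> Ident D X = Ident C (u X)) \<and>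
     (\<forall>X \<in> Obj D. \<forall>Y \<in> Obj D. Hom D X Y \<subseteq> Hom C (u X) (u Y)) \<and>
     (\<forall>X \<in> Obj D. \<forall>Y \<in> Obj D. \<forall>Z \<in> Obj D. \<forall>f \<in> Hom D X Y. \<forall>g \<in> Hom D Y Z.
        Comp D X Y Z g f = Comp C (u X) (u Y) (u Z) g f)"


section \<open>Basic covers and convergent covers\<close>

text \<open>As usual for records with a carrier, values outside the carrier are irrelevant.\<close>

record 'a basic_cover = "'a partial_object" +
  cov :: "'a \<Rightarrow> 'a set \<Rightarrow> bool"

record 'a conv_cover = "'a basic_cover" +
  cop :: "'a set \<Rightarrow> 'a set \<Rightarrow> 'a set"

definition covers :: "('a, 'x) basic_cover_scheme \<Rightarrow> 'a set \<Rightarrow> 'a set \<Rightarrow> bool" where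
  "covers X U V \<longleftrightarrow> (\<forall>b \<in> U. cov X b V)"

definition saturate :: "('a, 'x) basic_cover_scheme \<Rightarrow> 'a set \<Rightarrow> 'a set" where
  "saturate X U = {a \<in> carrier X. cov X a U}"

definition Sat :: "('a, 'x) basic_cover_scheme \<Rightarrow> 'a set set" where
  "Sat X = {U. U \<subseteq> carrier X \<and> U = saturate X U}"

locale basic_cover =
  fixes X :: "('a, 'x) basic_cover_scheme"
  assumes cov_refl: "\<lbrakk>U \<subseteq> carrier X; a \<in> U\<rbrakk> \<Longrightarrow> cov X a U"
    and cov_trans: "\<lbrakk>a \<in> carrier X; U \<subseteq> carrier X; V \<subseteq> carrier X; cov X a U; covers X U V\<rbrakk>
      \<Longrightarrow> cov X a V"

definition sat_join :: "('a, 'x) basic_cover_scheme \<Rightarrow> 'a set set \<Rightarrow> 'a set" where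
  "sat_join X \<U> = saturate X (\<Union>\<U>)"

text \<open>
  The operation on saturated sets induced by \<open>cop\<close>; a saturated set is its own saturation, so
  it serves as the representative.
\<close>

definition sat_op :: "('a, 'x) conv_cover_scheme \<Rightarrow> 'a set \<Rightarrow> 'a set \<Rightarrow> 'a set" where
  "sat_op X U V = saturate X (cop X U V)"

locale convergent_cover = basic_cover X for X :: "('a, 'x) conv_cover_scheme" +
  assumes cop_closed: "\<lbrakk>U \<subseteq> carrier X; V \<subseteq> carrier X\<rbrakk> \<Longrightarrow> cop X U V \<subseteq> carrier X"
    and cop_mono: "\<lbrakk>U1 \<subseteq> carrier X; V1 \<subseteq> carrier X; U2 \<subseteq> carrier X; V2 \<subseteq> carrier X;
        covers X U1 V1; covers X U2 V2\<rbrakk> \<Longrightarrow> covers X (cop X U1 U2) (cop X V1 V2)"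
    and cop_assoc: "\<lbrakk>U \<subseteq> carrier X; V \<subseteq> carrier X; W \<subseteq> carrier X\<rbrakk>
      \<Longrightarrow> covers X (cop X (cop X U V) W) (cop X U (cop X V W))"
    and cop_comm: "\<lbrakk>U \<subseteq> carrier X; V \<subseteq> carrier X\<rbrakk> \<Longrightarrow> covers X (cop X U V) (cop X V U)"
    and sat_op_join_left: "\<lbrakk>\<U> \<subseteq> Sat X; V \<in> Sat X\<rbrakk>
      \<Longrightarrow> sat_op X (sat_join X \<U>) V = sat_join X ((\<lambda>U. sat_op X U V) ` \<U>)"
    and sat_op_join_right: "\<lbrakk>\<U> \<subseteq> Sat X; V \<in> Sat X\<rbrakk>
      \<Longrightarrow> sat_op X V (sat_join X \<U>) = sat_join X ((\<lambda>U. sat_op X V U) ` \<U>)"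

text \<open>The preimage of \<open>V\<close> under a relation \<open>r\<close> is \<open>r\<inverse> `` V\<close>.\<close>

definition basic_cover_maps ::
  "('a, 'x) basic_cover_scheme \<Rightarrow> ('b, 'y) basic_cover_scheme \<Rightarrow> ('a \<times> 'b) set set" where
  "basic_cover_maps X Y = {r. r \<subseteq> carrier X \<times> carrier Y \<and>
     (\<forall>b \<in> carrier Y. \<forall>V \<subseteq> carrier Y. cov Y b V \<longrightarrow> covers X (r\<inverse> `` {b}) (r\<inverse> `` V))}"

definition conv_cover_maps ::
  "('a, 'x) conv_cover_scheme \<Rightarrow> ('b, 'y) conv_cover_scheme \<Rightarrow> ('a \<times> 'b) set set" where
  "conv_cover_maps X Y = {r \<in> basic_cover_maps X Y. \<forall>b1 \<in> carrier Y. \<forall>b2 \<in> carrier Y.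
     saturate X (r\<inverse> `` (cop Y {b1} {b2})) = saturate X (cop X (r\<inverse> `` {b1}) (r\<inverse> `` {b2}))}"

text \<open>
  Equality of maps, on a given set \<open>M\<close> of maps. The arrows of the categories of covers are
  equivalence classes for it.
\<close>

definition map_eq ::
  "('a \<times> 'b) set set \<Rightarrow> ('a, 'x) basic_cover_scheme \<Rightarrow> ('b, 'y) basic_cover_scheme \<Rightarrow>
   ('a \<times> 'b) set rel" where
  "map_eq M X Y = {(r1, r2) \<in> M \<times> M.
     \<forall>b \<in> carrier Y. saturate X (r1\<inverse> `` {b}) = saturate X (r2\<inverse> `` {b})}"

definition cover_category ::
  "('a, 'x) basic_cover_scheme set \<Rightarrow>
   (('a, 'x) basic_cover_scheme \<Rightarrow> ('a, 'x) basic_cover_scheme \<Rightarrow> 'a rel set) \<Rightarrow>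
   (('a, 'x) basic_cover_scheme, 'a rel set) precat" where
  "cover_category obs maps =
     \<lparr>Obj = obs,
      Hom = (\<lambda>X Y. maps X Y // map_eq (maps X Y) X Y),
      Ident = (\<lambda>X. map_eq (maps X X) X X `` {Id_on (carrier X)}),
      Comp = (\<lambda>X Y Z S R. \<Union>s \<in> S. \<Union>r \<in> R. map_eq (maps X Z) X Z `` {r O s})\<rparr>"

text \<open>
  In all categories below, the role of the collection of all sets is played by a family
  \<open>\<S>\<close> of sets over some type: the carriers of the objects are the members of \<open>\<S>\<close>.
\<close>

definition BCov :: "'a set set \<Rightarrow> ('a basic_cover, 'a rel set) precat" where
  "BCov \<S> = cover_category {X. basic_cover X \<and> carrier X \<in> \<S>} basic_cover_maps"

definition CBCov :: "'a set set \<Rightarrow> ('a conv_cover, 'a rel set) precat" where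
  "CBCov \<S> = cover_category {X. convergent_cover X \<and> carrier X \<in> \<S>} conv_cover_maps"

text \<open>
  Powersets of sets are sets. A type cannot contain all subsets of itself as elements, so the
  powerset of a member of \<open>\<S>\<close> is only required to be in bijection with a member of \<open>\<S>\<close>.
  Subsets of sets are sets as well (separation).
\<close>

definition impredicative_universe :: "'a set set \<Rightarrow> bool" where
  "impredicative_universe \<S> \<longleftrightarrow>
     (\<forall>S \<in> \<S>. \<forall>T \<subseteq> S. T \<in> \<S>) \<and> (\<forall>S \<in> \<S>. \<exists>P \<in> \<S>. Pow S \<approx> P)"


section \<open>Commutative quantales\<close>

record 'a quantale = "'a gorder" +
  qmult :: "'a \<Rightarrow> 'a \<Rightarrow> 'a"

locale suplattice = partial_order L for L (structure) +
  assumes sup_exists: "A \<subseteq> carrier L \<Longrightarrow> \<exists>s. least L s (Upper L A)"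

locale comm_quantale = suplattice Q for Q :: "('a, 'x) quantale_scheme" (structure) +
  assumes qmult_closed: "\<lbrakk>x \<in> carrier Q; y \<in> carrier Q\<rbrakk> \<Longrightarrow> qmult Q x y \<in> carrier Q"
    and qmult_assoc: "\<lbrakk>x \<in> carrier Q; y \<in> carrier Q; z \<in> carrier Q\<rbrakk>
      \<Longrightarrow> qmult Q (qmult Q x y) z = qmult Q x (qmult Q y z)"
    and qmult_comm: "\<lbrakk>x \<in> carrier Q; y \<in> carrier Q\<rbrakk> \<Longrightarrow> qmult Q x y = qmult Q y x"
    and qmult_sup_left: "\<lbrakk>A \<subseteq> carrier Q; y \<in> carrier Q\<rbrakk>
      \<Longrightarrow> qmult Q (\<Squnion>\<^bsub>Q\<^esub>A) y = \<Squnion>\<^bsub>Q\<^esub>((\<lambda>x. qmult Q x y) ` A)"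
    and qmult_sup_right: "\<lbrakk>A \<subseteq> carrier Q; y \<in> carrier Q\<rbrakk>
      \<Longrightarrow> qmult Q y (\<Squnion>\<^bsub>Q\<^esub>A) = \<Squnion>\<^bsub>Q\<^esub>((\<lambda>x. qmult Q y x) ` A)"

definition quantale_maps ::
  "('a, 'x) quantale_scheme \<Rightarrow> ('b, 'y) quantale_scheme \<Rightarrow> ('a \<Rightarrow> 'b) set" where
  "quantale_maps Q R = {f \<in> carrier Q \<rightarrow>\<^sub>E carrier R.
     (\<forall>A \<subseteq> carrier Q. f (\<Squnion>\<^bsub>Q\<^esub>A) = \<Squnion>\<^bsub>R\<^esub>(f ` A)) \<and>
     (\<forall>x \<in> carrier Q. \<forall>y \<in> carrier Q. f (qmult Q x y) = qmult R (f x) (f y))}"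

definition cQu :: "'a set set \<Rightarrow> ('a quantale, 'a \<Rightarrow> 'a) precat" where
  "cQu \<S> =
     \<lparr>Obj = {Q. comm_quantale Q \<and> carrier Q \<in> \<S>},
      Hom = quantale_maps,
      Ident = (\<lambda>Q. \<lambda>x \<in> carrier Q. x),
      Comp = (\<lambda>P Q R g f. compose (carrier P) g f)\<rparr>"

text \<open>Isomorphism of quantales whose carriers may live in different types.\<close>

definition quantale_isomorphic ::
  "('a, 'x) quantale_scheme \<Rightarrow> ('b, 'y) quantale_scheme \<Rightarrow> bool" where
  "quantale_isomorphic Q R \<longleftrightarrow>
     (\<exists>f \<in> quantale_maps Q R. \<exists>g \<in> quantale_maps R Q.
        (\<forall>x \<in> carrier Q. g (f x) = x) \<and> (\<forall>y \<in> carrier R. f (g y) = y))"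


section \<open>The quantale of saturated sets\<close>

definition sat_quantale :: "'a conv_cover \<Rightarrow> 'a set quantale" where
  "sat_quantale X = \<lparr>carrier = Sat X, eq = (=), le = (\<subseteq>), qmult = sat_op X\<rparr>"

text \<open>
  The functor sends (the class of) a map \<open>r\<close> from \<open>X\<close> to \<open>Y\<close> to the map taking \<open>V\<close> to the
  saturation of the preimage of \<open>V\<close>; this does not depend on the representative \<open>r\<close> of the
  class \<open>R\<close>. The arguments \<open>Y\<close>, \<open>X\<close> are in the order of the opposite category.
\<close>

definition sat_functor ::
  "('a conv_cover, 'a rel set, 'a set quantale, 'a set \<Rightarrow> 'a set) prefunctor" where
  "sat_functor =
     \<lparr>on_obj = sat_quantale,
      on_hom = (\<lambda>Y X R. \<lambda>V \<in> Sat Y. \<Union>r \<in> R. saturate X (r\<inverse> `` V))\<rparr>"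

end

theory Submission
  imports Defs
begin

text \<open>
  A map of covers counts only through what it does to saturated sets. If \<open>r\<close> is a basic cover map
  from \<open>X\<close> to \<open>Y\<close>, the operation sending \<open>V\<close> to the saturation of its preimage is insensitive to
  saturating \<open>V\<close> first, so it is a join preserving map \<open>Sat Y \<rightarrow> Sat X\<close>; it determines \<open>r\<close> up to
  equality of maps, and it sends composites of relations to composites in the reverse order. Hence
  composition is well defined on classes of maps, and the saturated sets form a contravariant
  functor.

  In a convergent cover the operation of two subsets is, up to saturation, the union of the
  operations of their points, because it distributes over joins. So the condition on points that
  defines a convergent cover map says that the induced map \<open>Sat Y \<rightarrow> Sat X\<close> preserves
  multiplication (\<open>conv_cover_maps_iff\<close>). This makes convergent cover maps closed under composition
  and under equality of basic cover maps, which gives the subcategory.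

  The functor of saturated sets is full (\<open>pullback_map_surj\<close>): a quantale map \<open>h\<close> from \<open>Sat Y\<close> to
  \<open>Sat X\<close> is determined by its values on the saturations of points, since these generate \<open>Sat Y\<close>
  under joins, and it is induced by the relation between \<open>a\<close> and \<open>b\<close> that says that \<open>a\<close> belongs to
  \<open>h\<close> of the saturation of \<open>b\<close>. It is faithful by the definition of equality of maps. Every
  commutative quantale \<open>Q\<close> arises: on the set of elements of \<open>Q\<close> let \<open>a\<close> be covered by \<open>U\<close> when
  \<open>a \<sqsubseteq> \<Squnion>U\<close>, and multiply subsets elementwise; the saturated sets are then the principal down-sets,
  and \<open>Sat\<close> of this cover is isomorphic to \<open>Q\<close>
  (\<open>quantale_isomorphic_sat_quantale_cover\<close>).

  What remains is size. The elements of \<open>Sat X\<close> are sets of elements of \<open>X\<close>, hence of a different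
  type. Impredicativity of the family \<open>\<S>\<close> of sets provides injections of powersets into members
  of \<open>\<S>\<close>, and carrying the quantale structure along them turns the functor of saturated sets into a
  functor to quantales with carrier in \<open>\<S>\<close>, still fully faithful and now essentially surjective.
  Such a functor is half of an equivalence (\<open>equivalence_if_essentially_surjective\<close>).
\<close>

section \<open>Saturations and preimages\<close>

context basic_cover
begin

lemma saturate_subset: "saturate X U \<subseteq> carrier X"
  by (auto simp: saturate_def)

lemma subset_saturate: "U \<subseteq> carrier X \<Longrightarrow> U \<subseteq> saturate X U"
  using cov_refl by (auto simp: saturate_def)

lemma covers_iff_subset: "U \<subseteq> carrier X \<Longrightarrow> covers X U V \<longleftrightarrow> U \<subseteq> saturate X V"
  by (auto simp: covers_def saturate_def)

lemma saturate_least: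
  assumes "U \<subseteq> saturate X V" "V \<subseteq> carrier X"
  shows "saturate X U \<subseteq> saturate X V"
proof -
  have U: "U \<subseteq> carrier X" using assms(1) saturate_subset by blast
  then have "covers X U V" using assms(1) covers_iff_subset by blast
  then show ?thesis using cov_trans[OF _ U assms(2)] by (auto simp: saturate_def)
qed

lemma covers_iff_saturate:
  "\<lbrakk>U \<subseteq> carrier X; V \<subseteq> carrier X\<rbrakk> \<Longrightarrow> covers X U V \<longleftrightarrow> saturate X U \<subseteq> saturate X V"
  using covers_iff_subset[of U V] saturate_least[of U V] subset_saturate[of U] by blast

lemma saturate_mono: "\<lbrakk>U \<subseteq> V; V \<subseteq> carrier X\<rbrakk> \<Longrightarrow> saturate X U \<subseteq> saturate X V"
  using saturate_least[of U V] subset_saturate[of V] by blast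

lemma saturate_idem: "U \<subseteq> carrier X \<Longrightarrow> saturate X (saturate X U) = saturate X U"
  by (rule subset_antisym) (simp_all add: saturate_least saturate_subset subset_saturate)

lemma saturate_in_Sat: "U \<subseteq> carrier X \<Longrightarrow> saturate X U \<in> Sat X"
  by (simp add: Sat_def saturate_idem saturate_subset)

lemma SatD: "U \<in> Sat X \<Longrightarrow> U \<subseteq> carrier X" "U \<in> Sat X \<Longrightarrow> saturate X U = U"
  by (simp_all add: Sat_def)

lemma saturate_UN:
  assumes "\<And>i. i \<in> I \<Longrightarrow> U i \<subseteq> carrier X"
  shows "saturate X (\<Union>i\<in>I. saturate X (U i)) = saturate X (\<Union>i\<in>I. U i)"
proof
  show "saturate X (\<Union>i\<in>I. saturate X (U i)) \<subseteq> saturate X (\<Union>i\<in>I. U i)"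
  proof (rule saturate_least)
    show "(\<Union>i\<in>I. saturate X (U i)) \<subseteq> saturate X (\<Union>i\<in>I. U i)"
      using assms by (intro UN_least saturate_mono) auto
  qed (use assms in auto)
  show "saturate X (\<Union>i\<in>I. U i) \<subseteq> saturate X (\<Union>i\<in>I. saturate X (U i))"
  proof (rule saturate_mono)
    show "(\<Union>i\<in>I. U i) \<subseteq> (\<Union>i\<in>I. saturate X (U i))"
      using assms subset_saturate by (intro UN_mono) auto
  qed (use saturate_subset in blast)
qed

end

text \<open>
The action of a relation on subsets, up to saturation. All facts about maps of covers below are
  phrased with it: maps are equal when their pullbacks are, and pullbacks compose.
\<close>

definition pullback :: "('a, 'x) basic_cover_scheme \<Rightarrow> ('a \<times> 'b) set \<Rightarrow> 'b set \<Rightarrow> 'a set" where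
  "pullback X r V = saturate X (r\<inverse> `` V)"

lemma preimage_subset: "r \<subseteq> A \<times> B \<Longrightarrow> r\<inverse> `` V \<subseteq> A"
  by auto

lemma pullback_UN:
  assumes "basic_cover X" "r \<subseteq> carrier X \<times> B"
  shows "pullback X r (\<Union>i\<in>I. V i) = saturate X (\<Union>i\<in>I. pullback X r (V i))"
proof -
  interpret basic_cover X by fact
  have "r\<inverse> `` (\<Union>i\<in>I. V i) = (\<Union>i\<in>I. r\<inverse> `` V i)" by auto
  then show ?thesis
    unfolding pullback_def by (simp add: saturate_UN preimage_subset[OF assms(2)])
qed

lemma pullback_points:
  assumes "basic_cover X" "r \<subseteq> carrier X \<times> B"
  shows "pullback X r V = saturate X (\<Union>b\<in>V. pullback X r {b})"
  using pullback_UN[OF assms, of "\<lambda>b. {b}" V] by simp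

text \<open>
Preserving the cover relation means precisely that the preimage of \<open>V\<close> already generates the
  preimage of everything covered by \<open>V\<close>.
\<close>

lemma basic_cover_maps_iff:
  assumes "basic_cover X" "basic_cover Y"
  shows "r \<in> basic_cover_maps X Y \<longleftrightarrow> r \<subseteq> carrier X \<times> carrier Y \<and>
    (\<forall>V \<subseteq> carrier Y. pullback X r (saturate Y V) = pullback X r V)" (is "?L \<longleftrightarrow> ?R")
proof -
  interpret X: basic_cover X by fact
  interpret Y: basic_cover Y by fact
  show ?thesis
  proof
    assume L: ?L
    then have sub: "r \<subseteq> carrier X \<times> carrier Y" by (simp add: basic_cover_maps_def)
    have "pullback X r (saturate Y V) = pullback X r V" if V: "V \<subseteq> carrier Y" for V
    proof
      have "r\<inverse> `` {b} \<subseteq> pullback X r V" if "b \<in> saturate Y V" for b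
        using that L V preimage_subset[OF sub] X.covers_iff_subset
        by (simp add: basic_cover_maps_def saturate_def[of Y] pullback_def)
      then show "pullback X r (saturate Y V) \<subseteq> pullback X r V"
        unfolding pullback_def using preimage_subset[OF sub]
        by (intro X.saturate_least) auto
      show "pullback X r V \<subseteq> pullback X r (saturate Y V)"
        unfolding pullback_def using Y.subset_saturate[OF V] preimage_subset[OF sub]
        by (intro X.saturate_mono) auto
    qed
    with sub show ?R by blast
  next
    assume R: ?R
    have "covers X (r\<inverse> `` {b}) (r\<inverse> `` V)"
      if "b \<in> carrier Y" "V \<subseteq> carrier Y" "cov Y b V" for b V
    proof -
      have "r\<inverse> `` {b} \<subseteq> r\<inverse> `` saturate Y V" using that by (auto simp: saturate_def)
      also have "\<dots> \<subseteq> pullback X r (saturate Y V)"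
        unfolding pullback_def using R by (intro X.subset_saturate preimage_subset) blast
      also have "\<dots> = pullback X r V" using R that by blast
      finally show ?thesis using R X.covers_iff_subset[OF preimage_subset]
        unfolding pullback_def by blast
    qed
    then show ?L using R by (simp add: basic_cover_maps_def)
  qed
qed

lemma pullback_saturate:
  "\<lbrakk>basic_cover X; basic_cover Y; r \<in> basic_cover_maps X Y; V \<subseteq> carrier Y\<rbrakk>
    \<Longrightarrow> pullback X r (saturate Y V) = pullback X r V"
  by (simp add: basic_cover_maps_iff)

lemma basic_cover_maps_subset: "r \<in> basic_cover_maps X Y \<Longrightarrow> r \<subseteq> carrier X \<times> carrier Y"
  by (simp add: basic_cover_maps_def)

text \<open>
The preimage under \<open>s\<close> may be saturated before it is pulled back along \<open>r\<close>, because \<open>r\<close> is a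
  cover map. This makes the composite of relations depend only on the classes of its factors.
\<close>

lemma pullback_comp:
  assumes "basic_cover X" "basic_cover Y" "r \<in> basic_cover_maps X Y" "s \<subseteq> carrier Y \<times> C"
  shows "pullback X (r O s) V = pullback X r (pullback Y s V)"
proof -
  have "pullback X (r O s) V = pullback X r (s\<inverse> `` V)"
    by (simp add: pullback_def converse_relcomp relcomp_Image)
  also have "\<dots> = pullback X r (pullback Y s V)"
    using pullback_saturate[OF assms(1-3) preimage_subset[OF assms(4)]]
    by (simp add: pullback_def[of Y])
  finally show ?thesis .
qed

lemma basic_cover_maps_comp:
  assumes "basic_cover X" "basic_cover Y" "basic_cover Z"
    "r \<in> basic_cover_maps X Y" "s \<in> basic_cover_maps Y Z"
  shows "r O s \<in> basic_cover_maps X Z"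
proof -
  note rs = assms(4,5)[THEN basic_cover_maps_subset]
  then have "r O s \<subseteq> carrier X \<times> carrier Z" by auto
  then show ?thesis
    using assms by (simp add: basic_cover_maps_iff[of X Z] pullback_comp[OF assms(1,2,4) rs(2)]
        pullback_saturate[OF assms(2,3,5)])
qed

lemma pullback_Id_on: "V \<subseteq> carrier X \<Longrightarrow> pullback X (Id_on (carrier X)) V = saturate X V"
  unfolding pullback_def by (rule arg_cong[where f = "saturate X"]) auto

lemma Id_on_basic_cover_maps:
  assumes "basic_cover X"
  shows "Id_on (carrier X) \<in> basic_cover_maps X X"
proof -
  interpret basic_cover X by fact
  show ?thesis
    using assms by (auto simp: basic_cover_maps_iff pullback_Id_on saturate_subset saturate_idem)
qed

section \<open>Convergent covers\<close>

context convergent_cover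
begin

lemma saturate_cop_saturate:
  assumes "U \<subseteq> carrier X" "V \<subseteq> carrier X"
  shows "saturate X (cop X (saturate X U) (saturate X V)) = saturate X (cop X U V)"
proof -
  have c: "covers X U (saturate X U)" "covers X (saturate X U) U"
    "covers X V (saturate X V)" "covers X (saturate X V) V"
    using assms by (simp_all add: covers_iff_saturate saturate_subset saturate_idem)
  note s = assms saturate_subset
  show ?thesis
    using cop_mono[OF s(1) s(3) s(2) s(3) c(1) c(3)] cop_mono[OF s(3) s(1) s(3) s(2) c(2) c(4)]
    by (simp add: covers_iff_saturate cop_closed s subset_antisym)
qed

text \<open>
Distributivity is an axiom about saturated sets; replacing subsets by their saturations carries it
  over to unions of arbitrary subsets.
\<close>

lemma saturate_cop_UN:
  assumes "\<And>i. i \<in> I \<Longrightarrow> U i \<subseteq> carrier X" "\<And>j. j \<in> J \<Longrightarrow> V j \<subseteq> carrier X"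
  shows "saturate X (cop X (\<Union>i\<in>I. U i) (\<Union>j\<in>J. V j)) =
    saturate X (\<Union>i\<in>I. \<Union>j\<in>J. saturate X (cop X (U i) (V j)))"
proof -
  have UJ: "(\<Union>i\<in>I. U i) \<subseteq> carrier X" "(\<Union>j\<in>J. V j) \<subseteq> carrier X" using assms by auto
  have joinI: "sat_join X ((\<lambda>i. saturate X (U i)) ` I) = saturate X (\<Union>i\<in>I. U i)"
    and joinJ: "sat_join X ((\<lambda>j. saturate X (V j)) ` J) = saturate X (\<Union>j\<in>J. V j)"
    using assms by (simp_all add: sat_join_def saturate_UN)
  have "saturate X (cop X (\<Union>i\<in>I. U i) (\<Union>j\<in>J. V j)) =
      sat_op X (saturate X (\<Union>i\<in>I. U i)) (saturate X (\<Union>j\<in>J. V j))"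
    by (simp add: sat_op_def saturate_cop_saturate UJ)
  also have "\<dots> = saturate X (\<Union>i\<in>I. sat_op X (saturate X (U i)) (saturate X (\<Union>j\<in>J. V j)))"
    unfolding joinI[symmetric] using assms UJ
    by (subst sat_op_join_left) (auto simp: saturate_in_Sat sat_join_def image_image)
  also have "\<dots> = saturate X (\<Union>i\<in>I. saturate X (\<Union>j\<in>J. saturate X (cop X (U i) (V j))))"
  proof (rule arg_cong[where f = "saturate X"], rule SUP_cong[OF refl])
    fix i assume "i \<in> I"
    then have "sat_op X (saturate X (U i)) (saturate X (\<Union>j\<in>J. V j)) =
        saturate X (\<Union>j\<in>J. sat_op X (saturate X (U i)) (saturate X (V j)))"
      unfolding joinJ[symmetric] using assms UJ
      by (subst sat_op_join_right) (auto simp: saturate_in_Sat sat_join_def image_image)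
    also have "\<dots> = saturate X (\<Union>j\<in>J. saturate X (cop X (U i) (V j)))"
      using assms \<open>i \<in> I\<close> by (simp add: sat_op_def saturate_cop_saturate)
    finally show "sat_op X (saturate X (U i)) (saturate X (\<Union>j\<in>J. V j)) =
        saturate X (\<Union>j\<in>J. saturate X (cop X (U i) (V j)))" .
  qed
  also have "\<dots> = saturate X (\<Union>i\<in>I. \<Union>j\<in>J. saturate X (cop X (U i) (V j)))"
    using saturate_subset by (intro saturate_UN) blast
  finally show ?thesis .
qed

lemma saturate_cop_points:
  assumes "U \<subseteq> carrier X" "V \<subseteq> carrier X"
  shows "saturate X (cop X U V) = saturate X (\<Union>a\<in>U. \<Union>b\<in>V. saturate X (cop X {a} {b}))"
  using saturate_cop_UN[of U "\<lambda>a. {a}" V "\<lambda>b. {b}"] assms by auto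

end

text \<open>
The condition on points extends to all subsets, since both sides turn unions into joins: the left
  one because pullbacks do, the right one by distributivity.
\<close>

lemma conv_cover_maps_iff:
  assumes "convergent_cover X" "convergent_cover Y"
  shows "r \<in> conv_cover_maps X Y \<longleftrightarrow> r \<in> basic_cover_maps X Y \<and>
    (\<forall>U \<subseteq> carrier Y. \<forall>V \<subseteq> carrier Y.
      pullback X r (cop Y U V) = saturate X (cop X (pullback X r U) (pullback X r V)))"
    (is "?L \<longleftrightarrow> ?R")
proof -
  interpret X: convergent_cover X by fact
  interpret Y: convergent_cover Y by fact
  have sub: "r\<inverse> `` V \<subseteq> carrier X" if "r \<in> basic_cover_maps X Y" for V
    using that basic_cover_maps_subset preimage_subset by metis
  have cs: "saturate X (cop X (pullback X r U) (pullback X r V)) =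
      saturate X (cop X (r\<inverse> `` U) (r\<inverse> `` V))" if "r \<in> basic_cover_maps X Y" for U V
    using sub[OF that] by (simp add: X.saturate_cop_saturate pullback_def)
  show ?thesis
  proof
    assume L: ?L
    then have b: "r \<in> basic_cover_maps X Y" by (simp add: conv_cover_maps_def)
    have "pullback X r (cop Y U V) = saturate X (cop X (pullback X r U) (pullback X r V))"
      if UV: "U \<subseteq> carrier Y" "V \<subseteq> carrier Y" for U V
    proof -
      note ps = pullback_saturate[OF X.basic_cover_axioms Y.basic_cover_axioms b]
      note pU = pullback_UN[OF X.basic_cover_axioms basic_cover_maps_subset[OF b]]
      have c: "cop Y {u} {v} \<subseteq> carrier Y" if "u \<in> U" "v \<in> V" for u v
        using UV that by (intro Y.cop_closed) auto
      have "pullback X r (cop Y U V) = pullback X r (saturate Y (cop Y U V))"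
        using UV by (simp add: ps Y.cop_closed)
      also have "\<dots> = pullback X r (\<Union>u\<in>U. \<Union>v\<in>V. saturate Y (cop Y {u} {v}))"
        unfolding Y.saturate_cop_points[OF UV] using Y.saturate_subset by (intro ps) blast
      also have "\<dots> = saturate X (\<Union>u\<in>U. saturate X (\<Union>v\<in>V. pullback X r (cop Y {u} {v})))"
        using c by (simp add: pU ps)
      also have "\<dots> = saturate X (\<Union>u\<in>U. \<Union>v\<in>V. pullback X r (cop Y {u} {v}))"
        unfolding pullback_def using X.saturate_subset by (intro X.saturate_UN) blast
      also have "\<dots> = saturate X (\<Union>u\<in>U. \<Union>v\<in>V. saturate X (cop X (r\<inverse> `` {u}) (r\<inverse> `` {v})))"
      proof (intro arg_cong[where f = "saturate X"] SUP_cong refl)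
        fix u v assume "u \<in> U" "v \<in> V"
        with L UV show "pullback X r (cop Y {u} {v}) =
            saturate X (cop X (r\<inverse> `` {u}) (r\<inverse> `` {v}))"
          unfolding pullback_def conv_cover_maps_def by blast
      qed
      also have "\<dots> = saturate X (cop X (\<Union>u\<in>U. r\<inverse> `` {u}) (\<Union>v\<in>V. r\<inverse> `` {v}))"
        using sub[OF b] by (subst X.saturate_cop_UN) auto
      also have "(\<Union>u\<in>U. r\<inverse> `` {u}) = r\<inverse> `` U" by auto
      also have "(\<Union>v\<in>V. r\<inverse> `` {v}) = r\<inverse> `` V" by auto
      finally show ?thesis by (simp add: cs[OF b])
    qed
    with b show ?R by blast
  next
    assume R: ?R
    then have "pullback X r (cop Y {b1} {b2}) =
        saturate X (cop X (r\<inverse> `` {b1}) (r\<inverse> `` {b2}))"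
      if "b1 \<in> carrier Y" "b2 \<in> carrier Y" for b1 b2
      using that cs[of "{b1}" "{b2}"] by auto
    with R show ?L by (auto simp: conv_cover_maps_def pullback_def)
  qed
qed

lemma conv_cover_maps_comp:
  assumes X: "convergent_cover X" and Y: "convergent_cover Y" and Z: "convergent_cover Z"
    and r: "r \<in> conv_cover_maps X Y" and s: "s \<in> conv_cover_maps Y Z"
  shows "r O s \<in> conv_cover_maps X Z"
proof -
  interpret X: convergent_cover X by fact
  interpret Y: convergent_cover Y by fact
  interpret Z: convergent_cover Z by fact
  note bc = X.basic_cover_axioms Y.basic_cover_axioms Z.basic_cover_axioms
  have rb: "r \<in> basic_cover_maps X Y" and sb: "s \<in> basic_cover_maps Y Z"
    using r s by (simp_all add: conv_cover_maps_def)
  note pc = pullback_comp[OF bc(1,2) rb basic_cover_maps_subset[OF sb]]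
  have pb: "pullback Y s V \<subseteq> carrier Y" for V
    by (simp add: pullback_def Y.saturate_subset)
  have "pullback X (r O s) (cop Z U V) =
      saturate X (cop X (pullback X (r O s) U) (pullback X (r O s) V))"
    if "U \<subseteq> carrier Z" "V \<subseteq> carrier Z" for U V
  proof -
    have "pullback X (r O s) (cop Z U V) = 
        pullback X r (saturate Y (cop Y (pullback Y s U) (pullback Y s V)))"
      using s that by (simp add: pc conv_cover_maps_iff[OF Y Z])
    also have "\<dots> = pullback X r (cop Y (pullback Y s U) (pullback Y s V))"
      using pullback_saturate[OF bc(1,2) rb Y.cop_closed[OF pb pb]] .
    also have "\<dots> = saturate X (cop X (pullback X (r O s) U) (pullback X (r O s) V))"
      using r pb by (simp add: pc conv_cover_maps_iff[OF X Y])
    finally show ?thesis .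
  qed
  then show ?thesis
    using basic_cover_maps_comp[OF bc rb sb] by (simp add: conv_cover_maps_iff[OF X Z])
qed

lemma Id_on_conv_cover_maps:
  assumes "convergent_cover X"
  shows "Id_on (carrier X) \<in> conv_cover_maps X X"
proof -
  interpret convergent_cover X by fact
  show ?thesis
    using Id_on_basic_cover_maps[OF basic_cover_axioms]
    by (simp add: conv_cover_maps_iff[OF assms assms] pullback_Id_on cop_closed
        saturate_cop_saturate)
qed

section \<open>The categories of covers\<close>

text \<open>
Pullbacks of unions are generated by pullbacks of points, so agreement on points is agreement on
  all subsets.
\<close>

lemma map_eq_iff_pullback:
  assumes "basic_cover X" "M \<subseteq> basic_cover_maps X Y"
  shows "(r1, r2) \<in> map_eq M X Y \<longleftrightarrow>
    r1 \<in> M \<and> r2 \<in> M \<and> (\<forall>V \<subseteq> carrier Y. pullback X r1 V = pullback X r2 V)"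
proof -
  have "pullback X r1 V = pullback X r2 V"
    if "(r1, r2) \<in> map_eq M X Y" "V \<subseteq> carrier Y" for V
  proof -
    have "r1 \<in> basic_cover_maps X Y" "r2 \<in> basic_cover_maps X Y"
      using that assms(2) by (auto simp: map_eq_def)
    note sub = this[THEN basic_cover_maps_subset]
    have "(\<Union>b\<in>V. pullback X r1 {b}) = (\<Union>b\<in>V. pullback X r2 {b})"
      using that by (auto simp: map_eq_def pullback_def)
    then show ?thesis using pullback_points[OF assms(1)] sub by metis
  qed
  then show ?thesis by (auto simp: map_eq_def pullback_def)
qed

lemma equiv_map_eq: "equiv M (map_eq M X Y)"
  by (rule equivI) (auto simp: map_eq_def refl_on_def sym_def trans_def)

lemma map_eq_subset: "map_eq M X Y \<subseteq> M \<times> M"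
  by (auto simp: map_eq_def)

text \<open>
Basic and convergent covers form categories for the same reason, so the construction is carried
  out once for any class of basic cover maps that is closed under composition and contains the
  identity relations.
\<close>

locale cover_cat =
  fixes obs :: "('a, 'x) basic_cover_scheme set"
    and maps :: "('a, 'x) basic_cover_scheme \<Rightarrow> ('a, 'x) basic_cover_scheme \<Rightarrow> 'a rel set"
  assumes obs_cover: "X \<in> obs \<Longrightarrow> basic_cover X"
    and maps_basic: "maps X Y \<subseteq> basic_cover_maps X Y"
    and maps_Id: "X \<in> obs \<Longrightarrow> Id_on (carrier X) \<in> maps X X"
    and maps_comp: "\<lbrakk>X \<in> obs; Y \<in> obs; Z \<in> obs; r \<in> maps X Y; s \<in> maps Y Z\<rbrakk>
      \<Longrightarrow> r O s \<in> maps X Z"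
begin

abbreviation arrow where "arrow X Y r \<equiv> map_eq (maps X Y) X Y `` {r}"

lemma maps_subset: "r \<in> maps X Y \<Longrightarrow> r \<subseteq> carrier X \<times> carrier Y"
  using maps_basic basic_cover_maps_subset by blast

lemma pullback_maps_comp:
  assumes "X \<in> obs" "Y \<in> obs" "r \<in> maps X Y" "s \<in> maps Y Z"
  shows "pullback X (r O s) V = pullback X r (pullback Y s V)"
  using pullback_comp[OF assms(1,2)[THEN obs_cover] _ maps_subset[OF assms(4)]] assms(3) maps_basic
  by blast

lemma hom_cases:
  assumes "R \<in> Hom (cover_category obs maps) X Y"
  obtains r where "r \<in> maps X Y" "R = arrow X Y r"
  using assms by (auto simp: cover_category_def elim: quotientE)

lemma arrow_in_hom: "r \<in> maps X Y \<Longrightarrow> arrow X Y r \<in> Hom (cover_category obs maps) X Y"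
  by (simp add: cover_category_def quotientI)

lemma arrow_eq_iff:
  assumes "X \<in> obs" "r1 \<in> maps X Y" "r2 \<in> maps X Y"
  shows "arrow X Y r1 = arrow X Y r2 \<longleftrightarrow> (\<forall>V \<subseteq> carrier Y. pullback X r1 V = pullback X r2 V)"
  using eq_equiv_class_iff[OF equiv_map_eq assms(2,3), of X Y]
    map_eq_iff_pullback[OF obs_cover maps_basic] assms by simp

text \<open>
Composites of different representatives have the same pullback, so the union over all
  representatives is a single class.
\<close>

lemma comp_arrow:
  assumes "X \<in> obs" "Y \<in> obs" "Z \<in> obs" "r \<in> maps X Y" "s \<in> maps Y Z"
  shows "Comp (cover_category obs maps) X Y Z (arrow Y Z s) (arrow X Y r) = arrow X Z (r O s)"
proof -
  have eq: "arrow X Z (r' O s') = arrow X Z (r O s)"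
    if r': "r' \<in> arrow X Y r" and s': "s' \<in> arrow Y Z s" for r' s'
  proof -
    have r'M: "r' \<in> maps X Y" and s'M: "s' \<in> maps Y Z"
      using r' s' map_eq_subset by blast+
    have rr: "pullback X r V = pullback X r' V" if "V \<subseteq> carrier Y" for V
      using r' that map_eq_iff_pullback[OF obs_cover maps_basic] assms by fastforce
    have ss: "pullback Y s V = pullback Y s' V" if "V \<subseteq> carrier Z" for V
      using s' that map_eq_iff_pullback[OF obs_cover maps_basic] assms by fastforce
    have "pullback X (r' O s') V = pullback X (r O s) V" if V: "V \<subseteq> carrier Z" for V
    proof -
      have "pullback X (r' O s') V = pullback X r' (pullback Y s' V)"
        using pullback_maps_comp[OF assms(1,2) r'M s'M] .
      also have "\<dots> = pullback X r (pullback Y s V)"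
        using rr ss V basic_cover.saturate_subset[OF obs_cover] assms
        by (simp add: pullback_def[of Y])
      also have "\<dots> = pullback X (r O s) V"
        using pullback_maps_comp[OF assms(1,2,4,5)] ..
      finally show ?thesis .
    qed
    then show ?thesis
      by (subst arrow_eq_iff) (use assms r'M s'M maps_comp in auto)
  qed
  have "r \<in> arrow X Y r" "s \<in> arrow Y Z s"
    using assms equiv_class_self[OF equiv_map_eq] by metis+
  moreover have "Comp (cover_category obs maps) X Y Z (arrow Y Z s) (arrow X Y r) =
      (\<Union>s'\<in>arrow Y Z s. \<Union>r'\<in>arrow X Y r. arrow X Z (r' O s'))"
    by (simp add: cover_category_def)
  ultimately show ?thesis using eq by blast
qed

lemma Obj_cover_category: "Obj (cover_category obs maps) = obs"
  and Ident_cover_category: "Ident (cover_category obs maps) X = arrow X X (Id_on (carrier X))"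
  by (simp_all add: cover_category_def)

lemma Id_on_relcomp: "r \<in> maps X Y \<Longrightarrow> Id_on (carrier X) O r = r"
  and relcomp_Id_on: "r \<in> maps X Y \<Longrightarrow> r O Id_on (carrier Y) = r"
  using maps_subset by fast+

lemma category: "category (cover_category obs maps)"
proof (unfold_locales, unfold Obj_cover_category Ident_cover_category)
  fix X assume "X \<in> obs"
  then show "arrow X X (Id_on (carrier X)) \<in> Hom (cover_category obs maps) X X"
    using arrow_in_hom maps_Id by blast
next
  fix X Y Z f g
  assume o: "X \<in> obs" "Y \<in> obs" "Z \<in> obs"
    and "f \<in> Hom (cover_category obs maps) X Y" "g \<in> Hom (cover_category obs maps) Y Z"
  then show "Comp (cover_category obs maps) X Y Z g f \<in> Hom (cover_category obs maps) X Z"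
    by (elim hom_cases) (simp add: comp_arrow arrow_in_hom maps_comp[OF o])
next
  fix X Y f
  assume "X \<in> obs" "Y \<in> obs" and "f \<in> Hom (cover_category obs maps) X Y"
  then show "Comp (cover_category obs maps) X X Y f (arrow X X (Id_on (carrier X))) = f"
    by (elim hom_cases) (simp add: comp_arrow maps_Id Id_on_relcomp)
next
  fix X Y f
  assume "X \<in> obs" "Y \<in> obs" and "f \<in> Hom (cover_category obs maps) X Y"
  then show "Comp (cover_category obs maps) X Y Y (arrow Y Y (Id_on (carrier Y))) f = f"
    by (elim hom_cases) (simp add: comp_arrow maps_Id relcomp_Id_on)
next
  fix W X Y Z f g h
  assume o: "W \<in> obs" "X \<in> obs" "Y \<in> obs" "Z \<in> obs"
    and "f \<in> Hom (cover_category obs maps) W X" "g \<in> Hom (cover_category obs maps) X Y"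
      "h \<in> Hom (cover_category obs maps) Y Z"
  then show "Comp (cover_category obs maps) W X Z (Comp (cover_category obs maps) X Y Z h g) f =
      Comp (cover_category obs maps) W Y Z h (Comp (cover_category obs maps) W X Y g f)"
    by (elim hom_cases)
      (simp add: comp_arrow maps_comp[OF o(1-3)] maps_comp[OF o(2-4)] O_assoc)
qed

end

interpretation BCov: cover_cat "{X. basic_cover X \<and> carrier X \<in> \<S>}" basic_cover_maps for \<S>
  by (rule cover_cat.intro) (blast intro: Id_on_basic_cover_maps basic_cover_maps_comp)+

interpretation CBCov: cover_cat "{X. convergent_cover X \<and> carrier X \<in> \<S>}" conv_cover_maps for \<S>
proof (rule cover_cat.intro)
  show "conv_cover_maps X Y \<subseteq> basic_cover_maps X Y" for X Y :: "('a, 'b) conv_cover_scheme"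
    by (auto simp: conv_cover_maps_def)
qed (blast intro: convergent_cover.axioms(1) Id_on_conv_cover_maps conv_cover_maps_comp)+

text \<open>
Being convergent depends on the pullback only, so a class of basic cover maps consists entirely of
  convergent ones or contains none. This is why the hom-sets of the smaller category are subsets of
  those of the larger one.
\<close>

lemma conv_cover_map_class:
  assumes X: "convergent_cover X" and Y: "convergent_cover Y" and r: "r \<in> conv_cover_maps X Y"
  shows "map_eq (conv_cover_maps X Y) X Y `` {r} = map_eq (basic_cover_maps X Y) X Y `` {r}"
proof -
  interpret X: convergent_cover X by fact
  interpret Y: convergent_cover Y by fact
  have "r' \<in> conv_cover_maps X Y" if "(r, r') \<in> map_eq (basic_cover_maps X Y) X Y" for r'
    using that r Y.cop_closed
    by (simp add: map_eq_iff_pullback[OF X.basic_cover_axioms] conv_cover_maps_iff[OF X Y])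
  then show ?thesis using r by (auto simp: map_eq_def conv_cover_maps_def)
qed

lemma truncate_simps [simp]:
  "carrier (basic_cover.truncate X) = carrier X"
  "cov (basic_cover.truncate X) = cov X"
  by (simp_all add: basic_cover.truncate_def)

lemma covers_truncate [simp]: "covers (basic_cover.truncate X) = covers X"
  by (intro ext) (simp add: covers_def)

lemma saturate_truncate [simp]: "saturate (basic_cover.truncate X) = saturate X"
  by (intro ext) (simp add: saturate_def)

lemma basic_cover_maps_truncate:
  "basic_cover_maps (basic_cover.truncate X) (basic_cover.truncate Y) = basic_cover_maps X Y"
  by (simp add: basic_cover_maps_def)

lemma map_eq_truncate: "map_eq M (basic_cover.truncate X) (basic_cover.truncate Y) = map_eq M X Y"
  by (simp add: map_eq_def)

lemma basic_cover_truncate: "basic_cover X \<Longrightarrow> basic_cover (basic_cover.truncate X)"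
  unfolding basic_cover_def truncate_simps covers_truncate .

theorem CBCov_subcategory: "subcategory_along basic_cover.truncate (CBCov \<S>) (BCov \<S>)"
proof -
  let ?u = "basic_cover.truncate :: 'a conv_cover \<Rightarrow> 'a basic_cover"
  let ?M = conv_cover_maps and ?B = basic_cover_maps
  have obj: "?u X \<in> {X. basic_cover X \<and> carrier X \<in> \<S>}"
    if "convergent_cover X" "carrier X \<in> \<S>" for X
    using that basic_cover_truncate convergent_cover.axioms(1) by auto
  have same_class: "map_eq (?M X Y) X Y `` {r} = map_eq (?B (?u X) (?u Y)) (?u X) (?u Y) `` {r}"
    if "convergent_cover X" "convergent_cover Y" "r \<in> ?M X Y" for X Y r
    using that by (simp add: conv_cover_map_class basic_cover_maps_truncate map_eq_truncate)
  have MB: "r \<in> ?B (?u X) (?u Y)" if "r \<in> ?M X Y" for r X Y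
    using that by (simp add: basic_cover_maps_truncate conv_cover_maps_def)
  have hom: "Hom (CBCov \<S>) X Y \<subseteq> Hom (BCov \<S>) (?u X) (?u Y)"
    if "X \<in> Obj (CBCov \<S>)" "Y \<in> Obj (CBCov \<S>)" for X Y
  proof
    fix R assume "R \<in> Hom (CBCov \<S>) X Y"
    then obtain r where "r \<in> ?M X Y" "R = map_eq (?M X Y) X Y `` {r}"
      unfolding CBCov_def by (rule CBCov.hom_cases)
    with that show "R \<in> Hom (BCov \<S>) (?u X) (?u Y)"
      unfolding BCov_def CBCov_def CBCov.Obj_cover_category
      by (simp add: same_class MB BCov.arrow_in_hom)
  qed
  have comp: "Comp (CBCov \<S>) X Y Z S R = Comp (BCov \<S>) (?u X) (?u Y) (?u Z) S R"
    if o: "X \<in> Obj (CBCov \<S>)" "Y \<in> Obj (CBCov \<S>)" "Z \<in> Obj (CBCov \<S>)"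
      and R: "R \<in> Hom (CBCov \<S>) X Y" and S: "S \<in> Hom (CBCov \<S>) Y Z" for X Y Z R S
  proof -
    have o': "convergent_cover X" "convergent_cover Y" "convergent_cover Z"
      "carrier X \<in> \<S>" "carrier Y \<in> \<S>" "carrier Z \<in> \<S>"
      using o by (simp_all add: CBCov_def CBCov.Obj_cover_category)
    obtain r where r: "r \<in> ?M X Y" "R = map_eq (?M X Y) X Y `` {r}"
      using R unfolding CBCov_def by (rule CBCov.hom_cases)
    obtain s where s: "s \<in> ?M Y Z" "S = map_eq (?M Y Z) Y Z `` {s}"
      using S unfolding CBCov_def by (rule CBCov.hom_cases)
    have "Comp (CBCov \<S>) X Y Z S R = map_eq (?M X Z) X Z `` {r O s}"
      unfolding CBCov_def r(2) s(2) using o' r s by (intro CBCov.comp_arrow) auto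
    also have "\<dots> = map_eq (?B (?u X) (?u Z)) (?u X) (?u Z) `` {r O s}"
      using o' r s by (simp add: same_class conv_cover_maps_comp[OF o'(1-3)])
    also have "\<dots> = Comp (BCov \<S>) (?u X) (?u Y) (?u Z) S R"
      unfolding BCov_def r(2) s(2) same_class[OF o'(1,2) r(1)] same_class[OF o'(2,3) s(1)]
      using o' r s MB obj by (intro BCov.comp_arrow[symmetric]) blast+
    finally show ?thesis .
  qed
  have "?u X \<in> Obj (BCov \<S>) \<and> Ident (CBCov \<S>) X = Ident (BCov \<S>) (?u X)"
    if "X \<in> Obj (CBCov \<S>)" for X
    using that obj[of X] same_class[of X X "Id_on (carrier X)"]
    unfolding BCov_def CBCov_def BCov.Obj_cover_category CBCov.Obj_cover_category
      BCov.Ident_cover_category CBCov.Ident_cover_category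
    by (simp add: Id_on_conv_cover_maps)
  moreover have "category (CBCov \<S>)" "category (BCov \<S>)"
    unfolding CBCov_def BCov_def by (rule CBCov.category BCov.category)+
  ultimately show ?thesis
    unfolding subcategory_along_def using hom comp by blast
qed

section \<open>Commutative quantales\<close>

context suplattice
begin

lemma is_lub_sup: "A \<subseteq> carrier L \<Longrightarrow> least L (\<Squnion>\<^bsub>L\<^esub>A) (Upper L A)"
  unfolding sup_def using sup_exists by (rule someI_ex)

lemma sup_closed: "A \<subseteq> carrier L \<Longrightarrow> \<Squnion>\<^bsub>L\<^esub>A \<in> carrier L"
  using is_lub_sup by (rule least_closed)

lemma sup_eqI: "\<lbrakk>A \<subseteq> carrier L; least L s (Upper L A)\<rbrakk> \<Longrightarrow> \<Squnion>\<^bsub>L\<^esub>A = s"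
  using is_lub_sup least_unique by blast

lemma sup_upper: "\<lbrakk>A \<subseteq> carrier L; x \<in> A\<rbrakk> \<Longrightarrow> x \<sqsubseteq> \<Squnion>\<^bsub>L\<^esub>A"
  by (rule least_Upper_above[OF is_lub_sup])

lemma sup_least: "\<lbrakk>A \<subseteq> carrier L; y \<in> carrier L; \<And>x. x \<in> A \<Longrightarrow> x \<sqsubseteq> y\<rbrakk> \<Longrightarrow> \<Squnion>\<^bsub>L\<^esub>A \<sqsubseteq> y"
  by (rule least_le[OF is_lub_sup]) (auto simp: Upper_def)

lemma sup_down:
  assumes "x \<in> carrier L"
  shows "\<Squnion>\<^bsub>L\<^esub>{y \<in> carrier L. y \<sqsubseteq> x} = x"
  by (rule sup_eqI) (use assms in \<open>auto intro!: least_UpperI\<close>)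

text \<open>
Associativity of joins.
\<close>

lemma sup_UN:
  assumes A: "\<And>i. i \<in> I \<Longrightarrow> A i \<subseteq> carrier L"
  shows "\<Squnion>\<^bsub>L\<^esub>(\<Union>i\<in>I. A i) = \<Squnion>\<^bsub>L\<^esub>((\<lambda>i. \<Squnion>\<^bsub>L\<^esub>(A i)) ` I)"
proof (rule sup_eqI)
  have I: "(\<lambda>i. \<Squnion>\<^bsub>L\<^esub>(A i)) ` I \<subseteq> carrier L" using A sup_closed by blast
  show U: "(\<Union>i\<in>I. A i) \<subseteq> carrier L" using A by blast
  show "least L (\<Squnion>\<^bsub>L\<^esub>((\<lambda>i. \<Squnion>\<^bsub>L\<^esub>(A i)) ` I)) (Upper L (\<Union>i\<in>I. A i))"
  proof (rule least_UpperI)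
    fix x assume "x \<in> (\<Union>i\<in>I. A i)"
    then obtain i where i: "i \<in> I" "x \<in> A i" by blast
    then have "x \<sqsubseteq> \<Squnion>\<^bsub>L\<^esub>(A i)" "\<Squnion>\<^bsub>L\<^esub>(A i) \<sqsubseteq> \<Squnion>\<^bsub>L\<^esub>((\<lambda>i. \<Squnion>\<^bsub>L\<^esub>(A i)) ` I)"
      using sup_upper[OF A] sup_upper[OF I] by auto
    then show "x \<sqsubseteq> \<Squnion>\<^bsub>L\<^esub>((\<lambda>i. \<Squnion>\<^bsub>L\<^esub>(A i)) ` I)"
      using i A sup_closed I by (meson le_trans subsetD)
  next
    fix y assume Uy: "y \<in> Upper L (\<Union>i\<in>I. A i)"
    have y: "y \<in> carrier L" using Uy Upper_closed by (rule rev_subsetD)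
    have below: "x \<sqsubseteq> y" if "i \<in> I" "x \<in> A i" for i x
      using Upper_memD[OF Uy _ U, of x] that by blast
    show "\<Squnion>\<^bsub>L\<^esub>((\<lambda>i. \<Squnion>\<^bsub>L\<^esub>(A i)) ` I) \<sqsubseteq> y"
    proof (rule sup_least[OF I y])
      fix x assume "x \<in> (\<lambda>i. \<Squnion>\<^bsub>L\<^esub>(A i)) ` I"
      then obtain i where i: "i \<in> I" "x = \<Squnion>\<^bsub>L\<^esub>(A i)" by blast
      then show "x \<sqsubseteq> y" using sup_least[OF A[OF i(1)] y below[OF i(1)]] by simp
    qed
  qed (use U sup_closed[OF I] in auto)
qed

end

lemma quantale_mapsD:
  assumes "f \<in> quantale_maps Q R"
  shows "f \<in> carrier Q \<rightarrow>\<^sub>E carrier R"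
    and "x \<in> carrier Q \<Longrightarrow> f x \<in> carrier R"
    and "A \<subseteq> carrier Q \<Longrightarrow> f (\<Squnion>\<^bsub>Q\<^esub>A) = \<Squnion>\<^bsub>R\<^esub>(f ` A)"
    and "\<lbrakk>x \<in> carrier Q; y \<in> carrier Q\<rbrakk> \<Longrightarrow> f (qmult Q x y) = qmult R (f x) (f y)"
  using assms by (auto simp: quantale_maps_def)

lemma quantale_maps_comp:
  assumes P: "comm_quantale P" and f: "f \<in> quantale_maps P Q" and g: "g \<in> quantale_maps Q R"
  shows "compose (carrier P) g f \<in> quantale_maps P R"
proof -
  interpret P: comm_quantale P by fact
  have "g (f (\<Squnion>\<^bsub>P\<^esub>A)) = \<Squnion>\<^bsub>R\<^esub>(compose (carrier P) g f ` A)" if A: "A \<subseteq> carrier P" for A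
  proof -
    have "f ` A \<subseteq> carrier Q" using A quantale_mapsD(2)[OF f] by blast
    moreover have "compose (carrier P) g f ` A = g ` f ` A"
      using A by (force simp: compose_def)
    ultimately show ?thesis using A by (simp add: quantale_mapsD(3)[OF f] quantale_mapsD(3)[OF g])
  qed
  moreover have "compose (carrier P) g f \<in> carrier P \<rightarrow>\<^sub>E carrier R"
    using quantale_mapsD(2)[OF f] quantale_mapsD(2)[OF g] by (auto simp: compose_def)
  ultimately show ?thesis
    using P.sup_closed P.qmult_closed quantale_mapsD(2,4)[OF f] quantale_mapsD(4)[OF g]
    by (simp add: quantale_maps_def compose_eq)
qed

lemma quantale_maps_id:
  assumes "comm_quantale Q"
  shows "(\<lambda>x\<in>carrier Q. x) \<in> quantale_maps Q Q"
proof -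
  interpret comm_quantale Q by fact
  have "(\<lambda>x\<in>carrier Q. x) ` A = A" if "A \<subseteq> carrier Q" for A
    using that by force
  then show ?thesis by (auto simp: quantale_maps_def sup_closed qmult_closed)
qed

lemma category_cQu: "category (cQu \<S>)"
proof (rule category.intro)
  fix W X Y Z f g h
  assume "W \<in> Obj (cQu \<S>)" "X \<in> Obj (cQu \<S>)" "Y \<in> Obj (cQu \<S>)" "Z \<in> Obj (cQu \<S>)"
    "f \<in> Hom (cQu \<S>) W X" "g \<in> Hom (cQu \<S>) X Y" "h \<in> Hom (cQu \<S>) Y Z"
  then show "Comp (cQu \<S>) W X Z (Comp (cQu \<S>) X Y Z h g) f =
      Comp (cQu \<S>) W Y Z h (Comp (cQu \<S>) W X Y g f)"
    by (auto simp: cQu_def compose_def quantale_mapsD(2))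
next
  fix X Y f assume "f \<in> Hom (cQu \<S>) X Y"
  then have f: "f \<in> carrier X \<rightarrow>\<^sub>E carrier Y" by (simp add: cQu_def quantale_mapsD)
  have "compose (carrier X) f (\<lambda>x\<in>carrier X. x) = f" "compose (carrier X) (\<lambda>y\<in>carrier Y. y) f = f"
    using f by (auto intro!: extensionalityI[of _ "carrier X"] simp: PiE_iff compose_eq compose_def)
  then show "Comp (cQu \<S>) X X Y f (Ident (cQu \<S>) X) = f"
    and "Comp (cQu \<S>) X Y Y (Ident (cQu \<S>) Y) f = f"
    by (simp_all add: cQu_def)
qed (simp_all add: cQu_def quantale_maps_id quantale_maps_comp)

text \<open>
Algebraic structure, infinitary joins included, is reflected by bijections that preserve it.
\<close>

lemma quantale_maps_inverse:
  assumes Q: "comm_quantale Q" and R: "comm_quantale R"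
    and f: "f \<in> quantale_maps Q R" and bij: "bij_betw f (carrier Q) (carrier R)"
  shows "(\<lambda>y\<in>carrier R. inv_into (carrier Q) f y) \<in> quantale_maps R Q" (is "?g \<in> _")
proof -
  interpret Q: comm_quantale Q by fact
  interpret R: comm_quantale R by fact
  have g_in: "?g y \<in> carrier Q" and fg: "f (?g y) = y" if "y \<in> carrier R" for y
    using that bij by (auto simp: bij_betw_imp_surj_on bij_betw_inv_into_right inv_into_into)
  have gI: "?g y = x" if "x \<in> carrier Q" "f x = y" for x y
    using that bij quantale_mapsD(2)[OF f] by (auto simp: bij_betw_inv_into_left)
  have "?g (\<Squnion>\<^bsub>R\<^esub>A) = \<Squnion>\<^bsub>Q\<^esub>(?g ` A)" if A: "A \<subseteq> carrier R" for A
  proof (rule gI)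
    have gA: "?g ` A \<subseteq> carrier Q" using A g_in by blast
    then show "\<Squnion>\<^bsub>Q\<^esub>(?g ` A) \<in> carrier Q" by (rule Q.sup_closed)
    have "f ` ?g ` A = (\<lambda>y. y) ` A"
      unfolding image_image using A fg by (intro image_cong) auto
    then show "f (\<Squnion>\<^bsub>Q\<^esub>(?g ` A)) = \<Squnion>\<^bsub>R\<^esub>A" using quantale_mapsD(3)[OF f gA] by simp
  qed
  moreover have "?g (qmult R x y) = qmult Q (?g x) (?g y)" 
    if "x \<in> carrier R" "y \<in> carrier R" for x y
    using that g_in fg by (intro gI Q.qmult_closed) (simp_all only: quantale_mapsD(4)[OF f])
  ultimately show ?thesis using g_in by (auto simp: quantale_maps_def)
qed

lemma quantale_isomorphicI:
  assumes "comm_quantale Q" "comm_quantale R" "f \<in> quantale_maps Q R"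
    "bij_betw f (carrier Q) (carrier R)"
  shows "quantale_isomorphic Q R"
  unfolding quantale_isomorphic_def
  using quantale_maps_inverse[OF assms] assms quantale_mapsD(2)[OF assms(3)]
  by (intro bexI[of _ f] bexI[of _ "\<lambda>y\<in>carrier R. inv_into (carrier Q) f y"])
    (simp_all add: bij_betw_inv_into_left bij_betw_inv_into_right)

lemma quantale_isomorphic_sym: "quantale_isomorphic Q R \<Longrightarrow> quantale_isomorphic R Q"
  unfolding quantale_isomorphic_def by blast

lemma quantale_isomorphic_trans:
  assumes "comm_quantale P" "comm_quantale R" "quantale_isomorphic P Q" "quantale_isomorphic Q R"
  shows "quantale_isomorphic P R"
proof -
  obtain f f' where f: "f \<in> quantale_maps P Q" "f' \<in> quantale_maps Q P"
      "\<forall>x\<in>carrier P. f' (f x) = x" "\<forall>y\<in>carrier Q. f (f' y) = y"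
    using assms(3) by (auto simp: quantale_isomorphic_def)
  obtain g g' where g: "g \<in> quantale_maps Q R" "g' \<in> quantale_maps R Q"
      "\<forall>x\<in>carrier Q. g' (g x) = x" "\<forall>y\<in>carrier R. g (g' y) = y"
    using assms(4) by (auto simp: quantale_isomorphic_def)
  show ?thesis
    unfolding quantale_isomorphic_def
  proof (intro bexI conjI)
    show "compose (carrier P) g f \<in> quantale_maps P R"
      "compose (carrier R) f' g' \<in> quantale_maps R P"
      using assms f g by (simp_all add: quantale_maps_comp)
  qed (use f g in \<open>simp_all add: compose_eq quantale_mapsD(2)\<close>)
qed

text \<open>
The relation \<open>quantale_isomorphic\<close> compares quantales over different types and can be chained
  through them; it yields an isomorphism of the category as soon as both ends belong to it.
\<close>

lemma isos_cQu_nonempty: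
  assumes "Q \<in> Obj (cQu \<S>)" "R \<in> Obj (cQu \<S>)" "quantale_isomorphic Q R"
  shows "isos (cQu \<S>) Q R \<noteq> {}"
proof -
  obtain f g where fg: "f \<in> quantale_maps Q R" "g \<in> quantale_maps R Q"
      "\<forall>x\<in>carrier Q. g (f x) = x" "\<forall>y\<in>carrier R. f (g y) = y"
    using assms(3) by (auto simp: quantale_isomorphic_def)
  then have "compose (carrier Q) g f = (\<lambda>x\<in>carrier Q. x)"
      "compose (carrier R) f g = (\<lambda>x\<in>carrier R. x)"
    by (auto simp: compose_def intro: restrict_ext)
  with fg have "f \<in> isos (cQu \<S>) Q R" by (auto simp: isos_def cQu_def)
  then show ?thesis by blast
qed

section \<open>The functor of saturated sets\<close>

lemma opposite_simps [simp]:
  "Obj (opposite C) = Obj C" "Hom (opposite C) X Y = Hom C Y X"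
  "Ident (opposite C) = Ident C" "Comp (opposite C) X Y Z g f = Comp C Z Y X f g"
  by (simp_all add: opposite_def)

lemma category_opposite:
  assumes "category C"
  shows "category (opposite C)"
proof -
  interpret category C by fact
  show ?thesis
    by unfold_locales
      (simp_all add: opposite_def ident_in comp_in comp_ident ident_comp comp_assoc)
qed

lemma carrier_sat_quantale [simp]: "carrier (sat_quantale X) = Sat X"
  and qmult_sat_quantale [simp]: "qmult (sat_quantale X) = sat_op X"
  and le_sat_quantale [simp]: "U \<sqsubseteq>\<^bsub>sat_quantale X\<^esub> V \<longleftrightarrow> U \<subseteq> V"
  and eq_sat_quantale [simp]: "U .=\<^bsub>sat_quantale X\<^esub> V \<longleftrightarrow> U = V"
  by (simp_all add: sat_quantale_def)

context convergent_cover
begin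

lemma Union_Sat_subset: "\<U> \<subseteq> Sat X \<Longrightarrow> \<Union>\<U> \<subseteq> carrier X"
  using SatD(1) by blast

lemma sat_op_saturate:
  assumes "U \<subseteq> carrier X" "V \<subseteq> carrier X"
  shows "sat_op X (saturate X U) (saturate X V) = saturate X (cop X U V)"
  using saturate_cop_saturate[OF assms] by (simp add: sat_op_def)

lemma sat_op_closed: "\<lbrakk>U \<in> Sat X; V \<in> Sat X\<rbrakk> \<Longrightarrow> sat_op X U V \<in> Sat X"
  by (simp add: sat_op_def saturate_in_Sat cop_closed SatD)

lemma sat_op_comm:
  assumes "U \<in> Sat X" "V \<in> Sat X"
  shows "sat_op X U V = sat_op X V U"
  using cop_comm assms[THEN SatD(1)] unfolding sat_op_def
  by (simp add: covers_iff_saturate cop_closed subset_antisym)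

text \<open>
  The axiom gives one inclusion. The other one is the same inclusion for the factors in reverse
  order, by commutativity.
\<close>

lemma sat_op_assoc:
  assumes "U \<in> Sat X" "V \<in> Sat X" "W \<in> Sat X"
  shows "sat_op X (sat_op X U V) W = sat_op X U (sat_op X V W)"
proof -
  have half: "sat_op X (sat_op X U V) W \<subseteq> sat_op X U (sat_op X V W)"
    if "U \<in> Sat X" "V \<in> Sat X" "W \<in> Sat X" for U V W
  proof -
    note sub = that[THEN SatD(1)]
    have "sat_op X (sat_op X U V) W = saturate X (cop X (cop X U V) W)"
      using sat_op_saturate[of "cop X U V" W] sub SatD(2)[OF that(3)]
      by (simp add: sat_op_def[of X U V] cop_closed)
    moreover have "sat_op X U (sat_op X V W) = saturate X (cop X U (cop X V W))"
      using sat_op_saturate[of U "cop X V W"] sub SatD(2)[OF that(1)]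
      by (simp add: sat_op_def[of X V W] cop_closed)
    ultimately show ?thesis
      using cop_assoc[OF sub] sub by (simp add: covers_iff_saturate cop_closed)
  qed
  have "sat_op X U (sat_op X V W) = sat_op X (sat_op X W V) U"
    using assms by (metis sat_op_comm sat_op_closed)
  also have "\<dots> \<subseteq> sat_op X W (sat_op X V U)" using half assms by blast
  also have "\<dots> = sat_op X (sat_op X U V) W"
    using assms by (metis sat_op_comm sat_op_closed)
  finally show ?thesis using half[OF assms] by blast
qed

end

context
  fixes X :: "'a conv_cover"
  assumes X: "convergent_cover X"
begin

interpretation convergent_cover X by (fact X)

lemma least_sat_join:
  assumes "\<U> \<subseteq> Sat X"
  shows "least (sat_quantale X) (sat_join X \<U>) (Upper (sat_quantale X) \<U>)"
proof (rule least_UpperI)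
  fix U assume "U \<in> \<U>"
  then show "U \<sqsubseteq>\<^bsub>sat_quantale X\<^esub> sat_join X \<U>"
    using subset_saturate[OF Union_Sat_subset[OF assms]] by (auto simp: sat_join_def)
next
  fix V assume V: "V \<in> Upper (sat_quantale X) \<U>"
  then have "V \<in> Sat X" "\<Union>\<U> \<subseteq> V" using assms by (auto simp: Upper_def)
  then show "sat_join X \<U> \<sqsubseteq>\<^bsub>sat_quantale X\<^esub> V"
    using saturate_mono[of "\<Union>\<U>" V] SatD[of V] by (simp add: sat_join_def)
qed (use assms Union_Sat_subset saturate_in_Sat in \<open>auto simp: sat_join_def\<close>)

lemma suplattice_sat_quantale: "suplattice (sat_quantale X)"
  by unfold_locales (use least_sat_join in \<open>auto simp: fun_eq_iff\<close>)

lemma sup_sat_quantale: "\<U> \<subseteq> Sat X \<Longrightarrow> \<Squnion>\<^bsub>sat_quantale X\<^esub>\<U> = sat_join X \<U>"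
  by (rule suplattice.sup_eqI[OF suplattice_sat_quantale]) (simp_all add: least_sat_join)

lemma comm_quantale_sat_quantale: "comm_quantale (sat_quantale X)"
proof (intro comm_quantale.intro comm_quantale_axioms.intro suplattice_sat_quantale)
  fix \<U> V assume UV: "\<U> \<subseteq> carrier (sat_quantale X)" "V \<in> carrier (sat_quantale X)"
  then have "(\<lambda>U. sat_op X U V) ` \<U> \<subseteq> Sat X" "(\<lambda>U. sat_op X V U) ` \<U> \<subseteq> Sat X"
    using sat_op_closed by auto
  then show "qmult (sat_quantale X) (\<Squnion>\<^bsub>sat_quantale X\<^esub>\<U>) V =
      \<Squnion>\<^bsub>sat_quantale X\<^esub>((\<lambda>U. qmult (sat_quantale X) U V) ` \<U>)"
    "qmult (sat_quantale X) V (\<Squnion>\<^bsub>sat_quantale X\<^esub>\<U>) =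
      \<Squnion>\<^bsub>sat_quantale X\<^esub>((\<lambda>U. qmult (sat_quantale X) V U) ` \<U>)"
    using UV by (simp_all add: sup_sat_quantale sat_op_join_left sat_op_join_right)
qed (simp_all add: sat_op_closed sat_op_assoc, simp add: sat_op_comm)

end

text \<open>
The pullback on saturated sets, extensional as the arrows of the category of quantales are.
\<close>

definition pullback_map ::
  "('a, 'x) basic_cover_scheme \<Rightarrow> ('b, 'y) basic_cover_scheme \<Rightarrow> ('a \<times> 'b) set \<Rightarrow> 'b set \<Rightarrow> 'a set"
  where "pullback_map X Y r = (\<lambda>V\<in>Sat Y. pullback X r V)"

lemma pullback_map_saturate:
  "\<lbrakk>basic_cover X; basic_cover Y; r \<in> basic_cover_maps X Y; V \<subseteq> carrier Y\<rbrakk>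
    \<Longrightarrow> pullback_map X Y r (saturate Y V) = pullback X r V"
  by (simp add: pullback_map_def basic_cover.saturate_in_Sat pullback_saturate)

lemma pullback_map_eq_iff:
  assumes X: "basic_cover X" and Y: "basic_cover Y"
    and r: "r1 \<in> basic_cover_maps X Y" "r2 \<in> basic_cover_maps X Y"
  shows "pullback_map X Y r1 = pullback_map X Y r2 \<longleftrightarrow>
    (\<forall>V \<subseteq> carrier Y. pullback X r1 V = pullback X r2 V)"
proof
  assume "pullback_map X Y r1 = pullback_map X Y r2"
  then show "\<forall>V \<subseteq> carrier Y. pullback X r1 V = pullback X r2 V"
    using r by (metis pullback_map_saturate[OF X Y])
next
  assume "\<forall>V \<subseteq> carrier Y. pullback X r1 V = pullback X r2 V"
  then show "pullback_map X Y r1 = pullback_map X Y r2"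
    unfolding pullback_map_def using basic_cover.SatD(1)[OF Y] by (intro restrict_ext) blast
qed

context
  fixes X :: "'a conv_cover" and Y :: "'b conv_cover"
  assumes X: "convergent_cover X" and Y: "convergent_cover Y"
begin

interpretation X: convergent_cover X by (fact X)
interpretation Y: convergent_cover Y by (fact Y)

lemma pullback_map_in:
  assumes r: "r \<in> conv_cover_maps X Y"
  shows "pullback_map X Y r \<in> quantale_maps (sat_quantale Y) (sat_quantale X)"
proof -
  have rb: "r \<in> basic_cover_maps X Y" using r by (simp add: conv_cover_maps_def)
  note ps = pullback_map_saturate[OF X.basic_cover_axioms Y.basic_cover_axioms rb]
  have ext: "pullback_map X Y r \<in> Sat Y \<rightarrow>\<^sub>E Sat X"
    using preimage_subset[OF basic_cover_maps_subset[OF rb]]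
    by (simp add: pullback_map_def pullback_def X.saturate_in_Sat)
  have "pullback_map X Y r (sat_join Y \<V>) = sat_join X (pullback_map X Y r ` \<V>)"
    if "\<V> \<subseteq> Sat Y" for \<V>
  proof -
    have "pullback_map X Y r (sat_join Y \<V>) = pullback X r (\<Union>\<V>)"
      using ps[OF Y.Union_Sat_subset[OF that]] by (simp add: sat_join_def)
    also have "\<dots> = saturate X (\<Union>V\<in>\<V>. pullback X r V)"
      using pullback_UN[OF X.basic_cover_axioms basic_cover_maps_subset[OF rb], of id \<V>] by simp
    also have "\<dots> = sat_join X (pullback_map X Y r ` \<V>)"
      using that by (auto simp: sat_join_def pullback_map_def subset_iff
          intro!: arg_cong[where f = "saturate X"])
    finally show ?thesis .
  qed
  moreover have "pullback_map X Y r (sat_op Y U V) =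
      sat_op X (pullback_map X Y r U) (pullback_map X Y r V)"
    if "U \<in> Sat Y" "V \<in> Sat Y" for U V
    using that r ps[of "cop Y U V"]
    by (simp add: conv_cover_maps_iff[OF X Y] sat_op_def Y.cop_closed Y.SatD pullback_map_def)
  moreover have "pullback_map X Y r ` \<V> \<subseteq> Sat X" if "\<V> \<subseteq> Sat Y" for \<V>
    using ext that by auto
  ultimately show ?thesis
    using ext by (simp add: quantale_maps_def sup_sat_quantale[OF X] sup_sat_quantale[OF Y])
qed

text \<open>
  Fullness. The preimage of a point \<open>b\<close> under the relation \<open>r\<close> below is \<open>h\<close> of the saturation of
  \<open>b\<close>, and both \<open>h\<close> and the pullback along \<open>r\<close> preserve the joins that build a saturated set from
  the saturations of its points.
\<close>

lemma pullback_map_surj: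
  assumes h: "h \<in> quantale_maps (sat_quantale Y) (sat_quantale X)"
  obtains r where "r \<in> conv_cover_maps X Y" "pullback_map X Y r = h"
proof -
  define r where "r = {(a, b). b \<in> carrier Y \<and> a \<in> h (saturate Y {b})}"
  have hS: "h (saturate Y V) \<in> Sat X" if "V \<subseteq> carrier Y" for V
    using quantale_mapsD(2)[OF h] that by (simp add: Y.saturate_in_Sat)
  have sub: "r \<subseteq> carrier X \<times> carrier Y"
    using X.SatD(1)[OF hS] by (force simp: r_def)
  have pr: "pullback X r V = h (saturate Y V)" if V: "V \<subseteq> carrier Y" for V
  proof -
    have S: "(\<lambda>b. saturate Y {b}) ` V \<subseteq> Sat Y"
      using V by (auto intro: Y.saturate_in_Sat)
    then have hS': "h ` (\<lambda>b. saturate Y {b}) ` V \<subseteq> Sat X"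
      using quantale_mapsD(2)[OF h] by auto
    have "h (saturate Y V) = h (sat_join Y ((\<lambda>b. saturate Y {b}) ` V))"
      using Y.saturate_UN[of V "\<lambda>b. {b}"] V by (simp add: sat_join_def subset_iff)
    also have "\<dots> = sat_join X (h ` (\<lambda>b. saturate Y {b}) ` V)"
      using quantale_mapsD(3)[OF h] S hS'
      by (simp add: sup_sat_quantale[OF X] sup_sat_quantale[OF Y])
    also have "\<Union>(h ` (\<lambda>b. saturate Y {b}) ` V) = r\<inverse> `` V"
      using V by (auto simp: r_def)
    then have "sat_join X (h ` (\<lambda>b. saturate Y {b}) ` V) = pullback X r V"
      by (simp add: sat_join_def pullback_def)
    finally show ?thesis by simp
  qed
  have rb: "r \<in> basic_cover_maps X Y"
    unfolding basic_cover_maps_iff[OF X.basic_cover_axioms Y.basic_cover_axioms]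
    using sub by (simp add: pr Y.saturate_subset Y.saturate_idem)
  moreover have "pullback X r (cop Y U V) = saturate X (cop X (pullback X r U) (pullback X r V))"
    if "U \<subseteq> carrier Y" "V \<subseteq> carrier Y" for U V
    using quantale_mapsD(4)[OF h, of "saturate Y U" "saturate Y V"] that
    by (simp add: pr Y.cop_closed Y.saturate_in_Sat Y.sat_op_saturate sat_op_def[of X])
  ultimately have "r \<in> conv_cover_maps X Y" by (simp add: conv_cover_maps_iff[OF X Y])
  moreover have "pullback_map X Y r = h"
    by (rule extensionalityI[of _ "Sat Y"])
      (use quantale_mapsD(1)[OF h] in \<open>simp_all add: pullback_map_def pr Y.SatD PiE_iff\<close>)
  ultimately show ?thesis using that by blast
qed

end

text \<open>
All representatives of a class have the same pullback, so the union in the definition of the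
  functor is a union of equal sets.
\<close>

lemma on_hom_sat_functor:
  assumes X: "convergent_cover X" and Y: "convergent_cover Y" and r: "r \<in> conv_cover_maps X Y"
  shows "on_hom sat_functor Y X (map_eq (conv_cover_maps X Y) X Y `` {r}) = pullback_map X Y r"
proof -
  interpret X: convergent_cover X by fact
  interpret Y: convergent_cover Y by fact
  let ?R = "map_eq (conv_cover_maps X Y) X Y `` {r}"
  have r_in: "r \<in> ?R" using equiv_class_self[OF equiv_map_eq r] .
  have "(\<Union>r'\<in>?R. pullback X r' V) = pullback X r V" if "V \<in> Sat Y" for V
  proof -
    have M: "conv_cover_maps X Y \<subseteq> basic_cover_maps X Y" by (auto simp: conv_cover_maps_def)
    have "pullback X r' V = pullback X r V" if "r' \<in> ?R" for r'
      using that Y.SatD(1)[OF \<open>V \<in> Sat Y\<close>]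
      by (auto simp: map_eq_iff_pullback[OF X.basic_cover_axioms M])
    then show ?thesis using r_in by blast
  qed
  then show ?thesis
    by (auto simp: sat_functor_def pullback_map_def pullback_def intro!: restrict_ext)
qed

lemma Obj_CBCov: "X \<in> Obj (CBCov \<S>) \<longleftrightarrow> convergent_cover X \<and> carrier X \<in> \<S>"
  by (simp add: CBCov_def CBCov.Obj_cover_category)

lemma Hom_CBCov_cases:
  assumes "R \<in> Hom (CBCov \<S>) X Y"
  obtains r where "r \<in> conv_cover_maps X Y" "R = map_eq (conv_cover_maps X Y) X Y `` {r}"
  using assms unfolding CBCov_def by (rule CBCov.hom_cases)

lemma bij_betw_sat_functor:
  assumes "X \<in> Obj (CBCov \<S>)" "Y \<in> Obj (CBCov \<S>)"
  shows "bij_betw (on_hom sat_functor Y X) (Hom (CBCov \<S>) X Y)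
    (quantale_maps (sat_quantale Y) (sat_quantale X))"
proof -
  let ?M = "conv_cover_maps X Y"
  let ?arrow = "\<lambda>r. map_eq ?M X Y `` {r}"
  have X: "convergent_cover X" and Y: "convergent_cover Y"
    using assms by (simp_all add: Obj_CBCov)
  interpret X: convergent_cover X by fact
  interpret Y: convergent_cover Y by fact
  have arrow_eq: "?arrow r1 = ?arrow r2"
    if "r1 \<in> ?M" "r2 \<in> ?M" "pullback_map X Y r1 = pullback_map X Y r2" for r1 r2
    using that CBCov.arrow_eq_iff[of X UNIV r1 Y r2] X
      pullback_map_eq_iff[OF X.basic_cover_axioms Y.basic_cover_axioms]
    by (simp add: conv_cover_maps_def)
  show ?thesis
    unfolding bij_betw_def
  proof (intro conjI inj_onI)
    fix R1 R2
    assume R: "R1 \<in> Hom (CBCov \<S>) X Y" "R2 \<in> Hom (CBCov \<S>) X Y"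
      and eq: "on_hom sat_functor Y X R1 = on_hom sat_functor Y X R2"
    obtain r1 where r1: "r1 \<in> ?M" "R1 = ?arrow r1" using R(1) by (rule Hom_CBCov_cases)
    obtain r2 where r2: "r2 \<in> ?M" "R2 = ?arrow r2" using R(2) by (rule Hom_CBCov_cases)
    have "pullback_map X Y r1 = pullback_map X Y r2"
      using eq unfolding r1(2) r2(2)
        on_hom_sat_functor[OF X Y r1(1)] on_hom_sat_functor[OF X Y r2(1)] .
    then show "R1 = R2"
      unfolding r1(2) r2(2) by (rule arrow_eq[OF r1(1) r2(1)])
  next
    show "on_hom sat_functor Y X ` Hom (CBCov \<S>) X Y =
        quantale_maps (sat_quantale Y) (sat_quantale X)"
    proof (intro subset_antisym subsetI)
      fix h assume "h \<in> on_hom sat_functor Y X ` Hom (CBCov \<S>) X Y"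
      then show "h \<in> quantale_maps (sat_quantale Y) (sat_quantale X)"
        by (auto elim!: Hom_CBCov_cases simp: on_hom_sat_functor[OF X Y] pullback_map_in[OF X Y])
    next
      fix h assume "h \<in> quantale_maps (sat_quantale Y) (sat_quantale X)"
      then obtain r where r: "r \<in> ?M" "pullback_map X Y r = h"
        by (rule pullback_map_surj[OF X Y])
      moreover have "?arrow r \<in> Hom (CBCov \<S>) X Y"
        unfolding CBCov_def using r(1) by (rule CBCov.arrow_in_hom)
      ultimately show "h \<in> on_hom sat_functor Y X ` Hom (CBCov \<S>) X Y"
        using on_hom_sat_functor[OF X Y r(1)] by (metis imageI)
    qed
  qed
qed

theorem cat_functor_sat_functor:
  "cat_functor (opposite (CBCov \<S>)) (cQu UNIV)
    (sat_functor :: ('u conv_cover, 'u rel set, _, _) prefunctor)"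
proof (intro cat_functor.intro cat_functor_axioms.intro category_cQu)
  show "category (opposite (CBCov \<S>))"
    unfolding CBCov_def by (rule category_opposite[OF CBCov.category])
next
  fix X assume "X \<in> Obj (opposite (CBCov \<S>))"
  then have X: "convergent_cover X" by (simp add: Obj_CBCov)
  interpret convergent_cover X by fact
  show "on_obj sat_functor X \<in> Obj (cQu UNIV)"
    by (simp add: sat_functor_def cQu_def comm_quantale_sat_quantale[OF X])
  have "pullback_map X X (Id_on (carrier X)) = (\<lambda>V\<in>Sat X. V)"
    unfolding pullback_map_def by (rule restrict_ext) (simp add: pullback_Id_on SatD)
  then have "on_hom sat_functor X X
      (map_eq (conv_cover_maps X X) X X `` {Id_on (carrier X)}) = (\<lambda>V\<in>Sat X. V)"
    using on_hom_sat_functor[OF X X Id_on_conv_cover_maps[OF X]] by simp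
  then show "on_hom sat_functor X X (Ident (opposite (CBCov \<S>)) X) =
      Ident (cQu UNIV) (on_obj sat_functor X)"
    by (simp add: CBCov_def CBCov.Ident_cover_category) (simp add: sat_functor_def cQu_def)
next
  fix X Y :: "'u conv_cover" and R
  assume "X \<in> Obj (opposite (CBCov \<S>))" "Y \<in> Obj (opposite (CBCov \<S>))"
    and R: "R \<in> Hom (opposite (CBCov \<S>)) X Y"
  then have "X \<in> Obj (CBCov \<S>)" "Y \<in> Obj (CBCov \<S>)" by simp_all
  from bij_betwE[OF bij_betw_sat_functor[OF this(2,1)]] R
  show "on_hom sat_functor X Y R \<in> Hom (cQu UNIV) (on_obj sat_functor X) (on_obj sat_functor Y)"
    by (simp add: sat_functor_def cQu_def)
next
  fix X Y Z :: "'u conv_cover" and R S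
  assume o: "X \<in> Obj (opposite (CBCov \<S>))" "Y \<in> Obj (opposite (CBCov \<S>))"
      "Z \<in> Obj (opposite (CBCov \<S>))"
    and R: "R \<in> Hom (opposite (CBCov \<S>)) X Y" and S: "S \<in> Hom (opposite (CBCov \<S>)) Y Z"
  then have X: "convergent_cover X" and Y: "convergent_cover Y" and Z: "convergent_cover Z"
    by (simp_all add: Obj_CBCov)
  interpret X: convergent_cover X by fact
  interpret Y: convergent_cover Y by fact
  interpret Z: convergent_cover Z by fact
  obtain r where r: "r \<in> conv_cover_maps Y X" "R = map_eq (conv_cover_maps Y X) Y X `` {r}"
    using R by (auto elim: Hom_CBCov_cases)
  obtain s where s: "s \<in> conv_cover_maps Z Y" "S = map_eq (conv_cover_maps Z Y) Z Y `` {s}"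
    using S by (auto elim: Hom_CBCov_cases)
  have rb: "r \<in> basic_cover_maps Y X" and sb: "s \<in> basic_cover_maps Z Y"
    using r s by (simp_all add: conv_cover_maps_def)
  have comp: "Comp (CBCov \<S>) Z Y X R S = map_eq (conv_cover_maps Z X) Z X `` {s O r}"
    unfolding CBCov_def r(2) s(2)
    using o r(1) s(1) by (intro CBCov.comp_arrow) (simp_all add: Obj_CBCov)
  have "pullback_map Z X (s O r) = compose (Sat X) (pullback_map Z Y s) (pullback_map Y X r)"
  proof (rule extensionalityI[of _ "Sat X"])
    fix V assume "V \<in> Sat X"
    then show "pullback_map Z X (s O r) V =
        compose (Sat X) (pullback_map Z Y s) (pullback_map Y X r) V"
      using pullback_comp[OF Z.basic_cover_axioms Y.basic_cover_axioms sb
          basic_cover_maps_subset[OF rb]]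
        Y.saturate_in_Sat[OF preimage_subset[OF basic_cover_maps_subset[OF rb]]]
      by (simp add: compose_eq pullback_map_def) (simp add: pullback_def)
  qed (simp_all add: pullback_map_def)
  then show "on_hom sat_functor X Z (Comp (opposite (CBCov \<S>)) X Y Z S R) =
      Comp (cQu UNIV) (on_obj sat_functor X) (on_obj sat_functor Y) (on_obj sat_functor Z)
        (on_hom sat_functor Y Z S) (on_hom sat_functor X Y R)"
    using on_hom_sat_functor[OF Z X conv_cover_maps_comp[OF Z Y X s(1) r(1)]]
      on_hom_sat_functor[OF Z Y s(1)] on_hom_sat_functor[OF Y X r(1)]
    by (simp add: comp flip: r(2) s(2)) (simp add: cQu_def sat_functor_def)
qed

lemma full_and_faithful_sat_functor:
  "full_and_faithful (opposite (CBCov \<S>)) (cQu UNIV) sat_functor"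
proof -
  have "bij_betw (on_hom sat_functor Y X) (Hom (CBCov \<S>) X Y)
      (Hom (cQu UNIV) (on_obj sat_functor Y) (on_obj sat_functor X))"
    if "X \<in> Obj (CBCov \<S>)" "Y \<in> Obj (CBCov \<S>)" for X Y
    using bij_betw_sat_functor[OF that] by (simp add: cQu_def sat_functor_def)
  then show ?thesis by (simp add: full_and_faithful_def)
qed

section \<open>The convergent cover presenting a quantale\<close>

text \<open>
The cover of which the quantale is the quantale of saturated sets: every element is a generator,
  and the relations are all inequalities \<open>a \<sqsubseteq> \<Squnion>U\<close>.
\<close>

definition quantale_cover :: "'a quantale \<Rightarrow> 'a conv_cover" where
  "quantale_cover Q = \<lparr>carrier = carrier Q, cov = (\<lambda>a U. a \<sqsubseteq>\<^bsub>Q\<^esub> \<Squnion>\<^bsub>Q\<^esub>U),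
     cop = (\<lambda>U V. {qmult Q a b | a b. a \<in> U \<and> b \<in> V})\<rparr>"

lemma quantale_cover_simps [simp]:
  "carrier (quantale_cover Q) = carrier Q"
  "cov (quantale_cover Q) a U \<longleftrightarrow> a \<sqsubseteq>\<^bsub>Q\<^esub> \<Squnion>\<^bsub>Q\<^esub>U"
  "cop (quantale_cover Q) U V = {qmult Q a b | a b. a \<in> U \<and> b \<in> V}"
  "saturate (quantale_cover Q) U = {a \<in> carrier Q. a \<sqsubseteq>\<^bsub>Q\<^esub> \<Squnion>\<^bsub>Q\<^esub>U}"
  by (simp_all add: quantale_cover_def saturate_def)

context
  fixes Q :: "'a quantale"
  assumes Q: "comm_quantale Q"
begin

interpretation comm_quantale Q by (fact Q)

text \<open>
A saturation is the principal down-set below a join, and it has the same join. Hence subsets have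
  the same saturation when they have the same join, and each law of a convergent cover reduces to
  the corresponding law of the quantale for the joins of the subsets involved.
\<close>

lemma sup_saturate: "U \<subseteq> carrier Q \<Longrightarrow> \<Squnion>\<^bsub>Q\<^esub>(saturate (quantale_cover Q) U) = \<Squnion>\<^bsub>Q\<^esub>U"
  by (simp add: sup_down sup_closed)

lemma saturate_eq_iff_sup:
  assumes "U \<subseteq> carrier Q" "V \<subseteq> carrier Q"
  shows "saturate (quantale_cover Q) U = saturate (quantale_cover Q) V \<longleftrightarrow> \<Squnion>\<^bsub>Q\<^esub>U = \<Squnion>\<^bsub>Q\<^esub>V"
proof
  assume "saturate (quantale_cover Q) U = saturate (quantale_cover Q) V"
  then show "\<Squnion>\<^bsub>Q\<^esub>U = \<Squnion>\<^bsub>Q\<^esub>V"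
    using sup_saturate[OF assms(1)] sup_saturate[OF assms(2)] by metis
qed simp

lemma covers_quantale_cover:
  "\<lbrakk>U \<subseteq> carrier Q; V \<subseteq> carrier Q\<rbrakk> \<Longrightarrow> covers (quantale_cover Q) U V \<longleftrightarrow> \<Squnion>\<^bsub>Q\<^esub>U \<sqsubseteq>\<^bsub>Q\<^esub> \<Squnion>\<^bsub>Q\<^esub>V"
proof
  assume UV: "U \<subseteq> carrier Q" "V \<subseteq> carrier Q" and "covers (quantale_cover Q) U V"
  then show "\<Squnion>\<^bsub>Q\<^esub>U \<sqsubseteq>\<^bsub>Q\<^esub> \<Squnion>\<^bsub>Q\<^esub>V"
    by (intro sup_least sup_closed) (auto simp: covers_def)
next
  assume UV: "U \<subseteq> carrier Q" "V \<subseteq> carrier Q" and "\<Squnion>\<^bsub>Q\<^esub>U \<sqsubseteq>\<^bsub>Q\<^esub> \<Squnion>\<^bsub>Q\<^esub>V"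
  then show "covers (quantale_cover Q) U V"
    using le_trans[OF sup_upper[OF UV(1)]] sup_closed by (auto simp: covers_def)
qed

lemma cop_carrier:
  "\<lbrakk>U \<subseteq> carrier Q; V \<subseteq> carrier Q\<rbrakk> \<Longrightarrow> cop (quantale_cover Q) U V \<subseteq> carrier Q"
  by (auto simp: subset_iff qmult_closed)

text \<open>
Distributivity in both arguments: multiplying elementwise and then joining is multiplying the
  joins.
\<close>

lemma sup_cop:
  assumes U: "U \<subseteq> carrier Q" and V: "V \<subseteq> carrier Q"
  shows "\<Squnion>\<^bsub>Q\<^esub>(cop (quantale_cover Q) U V) = qmult Q (\<Squnion>\<^bsub>Q\<^esub>U) (\<Squnion>\<^bsub>Q\<^esub>V)"
    (is "\<Squnion>\<^bsub>Q\<^esub>?P = _")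
proof -
  have "?P = (\<Union>a\<in>U. (\<lambda>b. qmult Q a b) ` V)" by auto
  moreover have "(\<lambda>b. qmult Q a b) ` V \<subseteq> carrier Q" if "a \<in> U" for a
    using that U V by (auto simp: subset_iff qmult_closed)
  ultimately have "\<Squnion>\<^bsub>Q\<^esub>?P = \<Squnion>\<^bsub>Q\<^esub>((\<lambda>a. \<Squnion>\<^bsub>Q\<^esub>((\<lambda>b. qmult Q a b) ` V)) ` U)"
    by (simp add: sup_UN)
  also have "(\<lambda>a. \<Squnion>\<^bsub>Q\<^esub>((\<lambda>b. qmult Q a b) ` V)) ` U = (\<lambda>a. qmult Q a (\<Squnion>\<^bsub>Q\<^esub>V)) ` U"
    using U by (intro image_cong HOL.refl) (auto simp: qmult_sup_right[OF V])
  finally show ?thesis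
    using U V by (simp add: qmult_sup_left sup_closed)
qed

text \<open>
Monotonicity comes from distributivity over the join of \<open>x\<close> and \<open>y\<close>, which is \<open>y\<close>.
\<close>

lemma qmult_mono_left:
  assumes x: "x \<in> carrier Q" "y \<in> carrier Q" "x \<sqsubseteq>\<^bsub>Q\<^esub> y" and z: "z \<in> carrier Q"
  shows "qmult Q x z \<sqsubseteq>\<^bsub>Q\<^esub> qmult Q y z"
proof -
  have "\<Squnion>\<^bsub>Q\<^esub>{x, y} = y"
    by (rule sup_eqI) (use x in \<open>auto intro!: least_UpperI\<close>)
  then have "qmult Q y z = \<Squnion>\<^bsub>Q\<^esub>{qmult Q x z, qmult Q y z}"
    using qmult_sup_left[of "{x, y}" z] x z by simp
  then show ?thesis
    using sup_upper[of "{qmult Q x z, qmult Q y z}" "qmult Q x z"] x z qmult_closed by simp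
qed

lemma qmult_mono:
  assumes "x \<in> carrier Q" "y \<in> carrier Q" "x \<sqsubseteq>\<^bsub>Q\<^esub> y" "z \<in> carrier Q" "w \<in> carrier Q" "z \<sqsubseteq>\<^bsub>Q\<^esub> w"
  shows "qmult Q x z \<sqsubseteq>\<^bsub>Q\<^esub> qmult Q y w"
  using qmult_mono_left[of x y z] qmult_mono_left[of z w y] assms
  by (metis le_trans qmult_closed qmult_comm)

lemma convergent_cover_quantale_cover:
  "convergent_cover (quantale_cover Q)" (is "convergent_cover ?C")
proof (unfold_locales, unfold quantale_cover_simps(1))
  fix U a assume "U \<subseteq> carrier Q" "a \<in> U"
  then show "cov ?C a U" by (simp add: sup_upper)
next
  fix a U V
  assume UV: "a \<in> carrier Q" "U \<subseteq> carrier Q" "V \<subseteq> carrier Q" and "cov ?C a U" "covers ?C U V"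
  then show "cov ?C a V"
    using le_trans[of a "\<Squnion>\<^bsub>Q\<^esub>U" "\<Squnion>\<^bsub>Q\<^esub>V"] by (simp add: covers_quantale_cover sup_closed)
next
  fix U V assume "U \<subseteq> carrier Q" "V \<subseteq> carrier Q"
  then show "cop ?C U V \<subseteq> carrier Q" by (rule cop_carrier)
next
  fix U1 V1 U2 V2
  assume s: "U1 \<subseteq> carrier Q" "V1 \<subseteq> carrier Q" "U2 \<subseteq> carrier Q" "V2 \<subseteq> carrier Q"
    and "covers ?C U1 V1" "covers ?C U2 V2"
  then show "covers ?C (cop ?C U1 U2) (cop ?C V1 V2)"
    unfolding covers_quantale_cover[OF s(1,2)] covers_quantale_cover[OF s(3,4)]
      covers_quantale_cover[OF cop_carrier[OF s(1,3)] cop_carrier[OF s(2,4)]]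
      sup_cop[OF s(1,3)] sup_cop[OF s(2,4)]
    by (intro qmult_mono sup_closed)
next
  fix U V W assume s: "U \<subseteq> carrier Q" "V \<subseteq> carrier Q" "W \<subseteq> carrier Q"
  note UV = cop_carrier[OF s(1,2)] and VW = cop_carrier[OF s(2,3)]
  have "\<Squnion>\<^bsub>Q\<^esub>(cop ?C (cop ?C U V) W) = \<Squnion>\<^bsub>Q\<^esub>(cop ?C U (cop ?C V W))"
    unfolding sup_cop[OF UV s(3)] sup_cop[OF s(1) VW] sup_cop[OF s(1,2)] sup_cop[OF s(2,3)]
    by (intro qmult_assoc sup_closed s)
  then show "covers ?C (cop ?C (cop ?C U V) W) (cop ?C U (cop ?C V W))"
    unfolding covers_quantale_cover[OF cop_carrier[OF UV s(3)] cop_carrier[OF s(1) VW]]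
    using sup_closed[OF cop_carrier[OF UV s(3)]] by (metis le_refl)
next
  fix U V assume s: "U \<subseteq> carrier Q" "V \<subseteq> carrier Q"
  have "\<Squnion>\<^bsub>Q\<^esub>(cop ?C U V) = \<Squnion>\<^bsub>Q\<^esub>(cop ?C V U)"
    unfolding sup_cop[OF s] sup_cop[OF s(2,1)] by (intro qmult_comm sup_closed s)
  then show "covers ?C (cop ?C U V) (cop ?C V U)"
    unfolding covers_quantale_cover[OF cop_carrier[OF s] cop_carrier[OF s(2,1)]]
    using sup_closed[OF cop_carrier[OF s]] by (metis le_refl)
next
  fix \<U> V assume U: "\<U> \<subseteq> Sat ?C" and V: "V \<in> Sat ?C"
  have sub: "U \<subseteq> carrier Q" if "U \<in> \<U>" for U using U that by (auto simp: Sat_def)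
  have Vs: "V \<subseteq> carrier Q" using V by (simp add: Sat_def)
  have sub': "\<Union>\<U> \<subseteq> carrier Q" "saturate ?C (\<Union>\<U>) \<subseteq> carrier Q" using sub by auto
  have sat: "\<Squnion>\<^bsub>Q\<^esub>(saturate ?C (\<Union>\<U>)) = \<Squnion>\<^bsub>Q\<^esub>((\<lambda>U. \<Squnion>\<^bsub>Q\<^esub>U) ` \<U>)"
    using sup_saturate[OF sub'(1)] sup_UN[of \<U> id] sub by simp
  have im: "(\<lambda>U. \<Squnion>\<^bsub>Q\<^esub>U) ` \<U> \<subseteq> carrier Q" using sub sup_closed by auto
  have sats: "saturate ?C W \<subseteq> carrier Q" for W by auto
  have L: "\<Squnion>\<^bsub>Q\<^esub>(\<Union>U\<in>\<U>. saturate ?C (cop ?C U V)) =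
      \<Squnion>\<^bsub>Q\<^esub>((\<lambda>x. qmult Q x (\<Squnion>\<^bsub>Q\<^esub>V)) ` (\<lambda>U. \<Squnion>\<^bsub>Q\<^esub>U) ` \<U>)"
    unfolding sup_UN[of \<U> "\<lambda>U. saturate ?C (cop ?C U V)", OF sats] image_image
    by (intro arg_cong[where f = "\<lambda>A. \<Squnion>\<^bsub>Q\<^esub>A"] image_cong HOL.refl)
      (rule HOL.trans[OF sup_saturate[OF cop_carrier[OF sub Vs]] sup_cop[OF sub Vs]])
  have R: "\<Squnion>\<^bsub>Q\<^esub>(\<Union>U\<in>\<U>. saturate ?C (cop ?C V U)) =
      \<Squnion>\<^bsub>Q\<^esub>((\<lambda>x. qmult Q (\<Squnion>\<^bsub>Q\<^esub>V) x) ` (\<lambda>U. \<Squnion>\<^bsub>Q\<^esub>U) ` \<U>)"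
    unfolding sup_UN[of \<U> "\<lambda>U. saturate ?C (cop ?C V U)", OF sats] image_image
    by (intro arg_cong[where f = "\<lambda>A. \<Squnion>\<^bsub>Q\<^esub>A"] image_cong HOL.refl)
      (rule HOL.trans[OF sup_saturate[OF cop_carrier[OF Vs sub]] sup_cop[OF Vs sub]])
  have "\<Squnion>\<^bsub>Q\<^esub>(cop ?C (saturate ?C (\<Union>\<U>)) V) = \<Squnion>\<^bsub>Q\<^esub>(\<Union>U\<in>\<U>. saturate ?C (cop ?C U V))"
    unfolding sup_cop[OF sub'(2) Vs] sat L by (rule qmult_sup_left[OF im sup_closed[OF Vs]])
  then show "sat_op ?C (sat_join ?C \<U>) V = sat_join ?C ((\<lambda>U. sat_op ?C U V) ` \<U>)"
    unfolding sat_op_def sat_join_def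
    by (subst saturate_eq_iff_sup[OF cop_carrier[OF sub'(2) Vs]]) (use sats in auto)
  have "\<Squnion>\<^bsub>Q\<^esub>(cop ?C V (saturate ?C (\<Union>\<U>))) = \<Squnion>\<^bsub>Q\<^esub>(\<Union>U\<in>\<U>. saturate ?C (cop ?C V U))"
    unfolding sup_cop[OF Vs sub'(2)] sat R by (rule qmult_sup_right[OF im sup_closed[OF Vs]])
  then show "sat_op ?C V (sat_join ?C \<U>) = sat_join ?C ((\<lambda>U. sat_op ?C V U) ` \<U>)"
    unfolding sat_op_def sat_join_def
    by (subst saturate_eq_iff_sup[OF cop_carrier[OF Vs sub'(2)]]) (use sats in auto)
qed

lemma sup_quantale_map:
  "(\<lambda>U\<in>Sat (quantale_cover Q). \<Squnion>\<^bsub>Q\<^esub>U) \<in> quantale_maps (sat_quantale (quantale_cover Q)) Q"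
  (is "?s \<in> quantale_maps (sat_quantale ?C) Q")
proof -
  have sub: "U \<subseteq> carrier Q" if "U \<in> Sat ?C" for U using that by (auto simp: Sat_def)
  interpret C: convergent_cover ?C by (rule convergent_cover_quantale_cover)
  have "?s (sat_join ?C \<U>) = \<Squnion>\<^bsub>Q\<^esub>(?s ` \<U>)" if U: "\<U> \<subseteq> Sat ?C" for \<U>
  proof -
    have U': "\<Union>\<U> \<subseteq> carrier Q" using U sub by blast
    then have "?s (sat_join ?C \<U>) = \<Squnion>\<^bsub>Q\<^esub>(\<Union>\<U>)"
      using C.saturate_in_Sat[of "\<Union>\<U>"] sup_saturate[OF U'] unfolding sat_join_def by simp
    also have "\<dots> = \<Squnion>\<^bsub>Q\<^esub>((\<lambda>U. \<Squnion>\<^bsub>Q\<^esub>U) ` \<U>)"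
      using sup_UN[of \<U> id] U sub by auto
    also have "(\<lambda>U. \<Squnion>\<^bsub>Q\<^esub>U) ` \<U> = ?s ` \<U>"
      using U by (intro image_cong) auto
    finally show ?thesis .
  qed
  moreover have "?s (sat_op ?C U V) = qmult Q (?s U) (?s V)" if "U \<in> Sat ?C" "V \<in> Sat ?C" for U V
  proof -
    note UV = that[THEN sub]
    have "?s (sat_op ?C U V) = \<Squnion>\<^bsub>Q\<^esub>(saturate ?C (cop ?C U V))"
      using C.sat_op_closed[OF that] unfolding sat_op_def by (rule restrict_apply')
    also have "\<dots> = qmult Q (\<Squnion>\<^bsub>Q\<^esub>U) (\<Squnion>\<^bsub>Q\<^esub>V)"
      using sup_saturate[OF cop_carrier[OF UV]] sup_cop[OF UV] by (rule HOL.trans)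
    finally show ?thesis using that by simp
  qed
  ultimately show ?thesis
    by (simp add: quantale_maps_def sup_sat_quantale[OF convergent_cover_quantale_cover]
        sup_closed[OF sub])
qed

text \<open>
Saturated sets are principal down-sets, recovered from their joins.
\<close>

lemma bij_betw_sup_Sat:
  "bij_betw (\<lambda>U\<in>Sat (quantale_cover Q). \<Squnion>\<^bsub>Q\<^esub>U) (Sat (quantale_cover Q)) (carrier Q)"
proof -
  interpret C: convergent_cover "quantale_cover Q" by (rule convergent_cover_quantale_cover)
  have S: "U \<subseteq> carrier Q" "{a \<in> carrier Q. a \<sqsubseteq>\<^bsub>Q\<^esub> \<Squnion>\<^bsub>Q\<^esub>U} = U" 
    if "U \<in> Sat (quantale_cover Q)" for U
    using C.SatD[OF that] by simp_all
  have down: "{a \<in> carrier Q. a \<sqsubseteq>\<^bsub>Q\<^esub> x} \<in> Sat (quantale_cover Q)" if "x \<in> carrier Q" for x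
    using that sup_down[OF that] by (simp add: Sat_def)
  show ?thesis
    by (rule bij_betw_byWitness[where f' = "\<lambda>x. {a \<in> carrier Q. a \<sqsubseteq>\<^bsub>Q\<^esub> x}"])
      (use S down sup_down sup_closed in auto)
qed

lemma quantale_isomorphic_sat_quantale_cover:
  "quantale_isomorphic Q (sat_quantale (quantale_cover Q))"
  using quantale_isomorphicI[OF comm_quantale_sat_quantale[OF convergent_cover_quantale_cover] Q
      sup_quantale_map] bij_betw_sup_Sat quantale_isomorphic_sym by simp

end

section \<open>Essentially surjective fully faithful functors\<close>

locale fully_faithful_functor = cat_functor C D F
  for C :: "('o, 'm) precat" and D :: "('p, 'n) precat" and F +
  assumes fully_faithful: "full_and_faithful C D F"
begin

definition lift :: "'o \<Rightarrow> 'o \<Rightarrow> 'n \<Rightarrow> 'm" where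
  "lift X Y = inv_into (Hom C X Y) (on_hom F X Y)"

lemma bij_on_hom:
  "\<lbrakk>X \<in> Obj C; Y \<in> Obj C\<rbrakk> \<Longrightarrow>
    bij_betw (on_hom F X Y) (Hom C X Y) (Hom D (on_obj F X) (on_obj F Y))"
  using fully_faithful by (simp add: full_and_faithful_def)

lemma lift_in:
  "\<lbrakk>X \<in> Obj C; Y \<in> Obj C; g \<in> Hom D (on_obj F X) (on_obj F Y)\<rbrakk> \<Longrightarrow> lift X Y g \<in> Hom C X Y"
  unfolding lift_def using bij_on_hom by (metis bij_betw_imp_surj_on inv_into_into)

lemma on_hom_lift:
  "\<lbrakk>X \<in> Obj C; Y \<in> Obj C; g \<in> Hom D (on_obj F X) (on_obj F Y)\<rbrakk> \<Longrightarrow> on_hom F X Y (lift X Y g) = g"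
  unfolding lift_def using bij_on_hom by (metis bij_betw_inv_into_right)

lemma faithful:
  "\<lbrakk>X \<in> Obj C; Y \<in> Obj C; f \<in> Hom C X Y; f' \<in> Hom C X Y; on_hom F X Y f = on_hom F X Y f'\<rbrakk>
    \<Longrightarrow> f = f'"
  using bij_on_hom by (meson bij_betw_imp_inj_on inj_on_def)

text \<open>
The lift of the inverse is inverse to the lift, since \<open>F\<close> is faithful.
\<close>

lemma lift_isos:
  assumes X: "X \<in> Obj C" and Y: "Y \<in> Obj C" and "e \<in> isos D (on_obj F X) (on_obj F Y)"
  shows "lift X Y e \<in> isos C X Y"
proof -
  obtain e' where e: "e \<in> Hom D (on_obj F X) (on_obj F Y)" "e' \<in> Hom D (on_obj F Y) (on_obj F X)"
      "Comp D (on_obj F X) (on_obj F Y) (on_obj F X) e' e = Ident D (on_obj F X)"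
      "Comp D (on_obj F Y) (on_obj F X) (on_obj F Y) e e' = Ident D (on_obj F Y)"
    using assms by (auto simp: isos_def)
  note l = lift_in[OF X Y e(1)] lift_in[OF Y X e(2)]
  note F = on_hom_lift[OF X Y e(1)] on_hom_lift[OF Y X e(2)]
  have "Comp C X Y X (lift Y X e') (lift X Y e) = Ident C X"
    using on_hom_comp[OF X Y X l] dom.comp_in[OF X Y X l] dom.ident_in[OF X]
    by (intro faithful[OF X X]) (simp_all add: F e on_hom_ident[OF X])
  moreover have "Comp C Y X Y (lift X Y e) (lift Y X e') = Ident C Y"
    using on_hom_comp[OF Y X Y l(2,1)] dom.comp_in[OF Y X Y l(2,1)] dom.ident_in[OF Y]
    by (intro faithful[OF Y Y]) (simp_all add: F e on_hom_ident[OF Y])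
  ultimately show ?thesis using l by (auto simp: isos_def)
qed

text \<open>
The inverse equivalence is built by choosing for each \<open>Y\<close> an object \<open>G Y\<close> and an isomorphism
  \<open>\<epsilon> Y : F (G Y) \<rightarrow> Y\<close>, and lifting conjugates by \<open>\<epsilon>\<close> through the bijections on hom-sets.
\<close>

theorem equivalence_if_essentially_surjective:
  assumes "\<And>Y. Y \<in> Obj D \<Longrightarrow> \<exists>X \<in> Obj C. isos D (on_obj F X) Y \<noteq> {}"
  shows "equivalent_categories C D"
proof -
  obtain G0 where G0: "\<And>Y. Y \<in> Obj D \<Longrightarrow> G0 Y \<in> Obj C \<and> isos D (on_obj F (G0 Y)) Y \<noteq> {}"
    using assms by metis
  define FG where "FG Y = on_obj F (G0 Y)" for Y
  obtain \<epsilon> where \<epsilon>_iso: "\<And>Y. Y \<in> Obj D \<Longrightarrow> \<epsilon> Y \<in> isos D (FG Y) Y"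
    using that[of "\<lambda>Y. SOME e. e \<in> isos D (FG Y) Y"] G0 by (simp add: FG_def some_in_eq)
  then obtain \<epsilon>' where \<epsilon>': "\<And>Y. Y \<in> Obj D \<Longrightarrow> \<epsilon>' Y \<in> Hom D Y (FG Y)"
      "\<And>Y. Y \<in> Obj D \<Longrightarrow> Comp D (FG Y) Y (FG Y) (\<epsilon>' Y) (\<epsilon> Y) = Ident D (FG Y)"
      "\<And>Y. Y \<in> Obj D \<Longrightarrow> Comp D Y (FG Y) Y (\<epsilon> Y) (\<epsilon>' Y) = Ident D Y"
    unfolding isos_def mem_Collect_eq Bex_def by metis
  have \<epsilon>: "\<epsilon> Y \<in> Hom D (FG Y) Y" if "Y \<in> Obj D" for Y
    using \<epsilon>_iso[OF that] by (simp add: isos_def)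
  have GC: "G0 Y \<in> Obj C" and FGD: "FG Y \<in> Obj D" if "Y \<in> Obj D" for Y
    using G0[OF that] on_obj_in by (simp_all add: FG_def)

  \<comment> \<open>the conjugate of \<open>g\<close> by \<open>\<epsilon>\<close>, which becomes the image of \<open>G g\<close> under \<open>F\<close>\<close>
  define K where "K Y Y' g = Comp D (FG Y) Y' (FG Y') (\<epsilon>' Y') (Comp D (FG Y) Y Y' g (\<epsilon> Y))"
    for Y Y' g
  have K_in: "K Y Y' g \<in> Hom D (FG Y) (FG Y')"
    and \<epsilon>_K: "Comp D (FG Y) (FG Y') Y' (\<epsilon> Y') (K Y Y' g) = Comp D (FG Y) Y Y' g (\<epsilon> Y)"
    if Y: "Y \<in> Obj D" "Y' \<in> Obj D" and g: "g \<in> Hom D Y Y'" for Y Y' g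
  proof -
    note FGY = FGD[OF Y(1)] FGD[OF Y(2)]
    have c: "Comp D (FG Y) Y Y' g (\<epsilon> Y) \<in> Hom D (FG Y) Y'"
      using cod.comp_in[OF FGY(1) Y \<epsilon>[OF Y(1)] g] .
    show "K Y Y' g \<in> Hom D (FG Y) (FG Y')"
      unfolding K_def using cod.comp_in[OF FGY(1) Y(2) FGY(2) c \<epsilon>'(1)[OF Y(2)]] .
    show "Comp D (FG Y) (FG Y') Y' (\<epsilon> Y') (K Y Y' g) = Comp D (FG Y) Y Y' g (\<epsilon> Y)"
      unfolding K_def
      using cod.comp_assoc[OF FGY(1) Y(2) FGY(2) Y(2) c \<epsilon>'(1)[OF Y(2)] \<epsilon>[OF Y(2)]]
        cod.ident_comp[OF FGY(1) Y(2) c] \<epsilon>'(3)[OF Y(2)] by simp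
  qed
  \<comment> \<open>\<open>\<epsilon> Y\<close> is a monomorphism, so the functor laws of \<open>K\<close> follow from naturality, \<open>\<epsilon>_K\<close>\<close>
  have cancel: "k = k'"
    if Y: "Y \<in> Obj D" and Z: "Z \<in> Obj D" and k: "k \<in> Hom D Z (FG Y)" "k' \<in> Hom D Z (FG Y)"
      and eq: "Comp D Z (FG Y) Y (\<epsilon> Y) k = Comp D Z (FG Y) Y (\<epsilon> Y) k'" for Y Z k k'
  proof -
    have "Comp D Z Y (FG Y) (\<epsilon>' Y) (Comp D Z (FG Y) Y (\<epsilon> Y) h) = h" if "h \<in> Hom D Z (FG Y)" for h
      using cod.comp_assoc[OF Z FGD[OF Y] Y FGD[OF Y] that \<epsilon>[OF Y] \<epsilon>'(1)[OF Y]]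
        cod.ident_comp[OF Z FGD[OF Y] that] \<epsilon>'(2)[OF Y] by simp
    with k eq show ?thesis by metis
  qed

  define G where "G = \<lparr>on_obj = G0, on_hom = (\<lambda>Y Y' g. lift (G0 Y) (G0 Y') (K Y Y' g))\<rparr>"
  have G_in: "on_hom G Y Y' g \<in> Hom C (G0 Y) (G0 Y')"
    and FG_hom: "on_hom F (G0 Y) (G0 Y') (on_hom G Y Y' g) = K Y Y' g"
    if Y: "Y \<in> Obj D" "Y' \<in> Obj D" and g: "g \<in> Hom D Y Y'" for Y Y' g
    using lift_in[OF GC[OF Y(1)] GC[OF Y(2)]] on_hom_lift[OF GC[OF Y(1)] GC[OF Y(2)]] K_in[OF that]
    by (simp_all add: G_def FG_def)
  have K_ident: "K Y Y (Ident D Y) = Ident D (FG Y)" if Y: "Y \<in> Obj D" for Y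
    using cod.ident_comp[OF FGD[OF Y] Y \<epsilon>[OF Y]] \<epsilon>'(2)[OF Y] by (simp add: K_def)
  have K_comp: "K X Z (Comp D X Y Z g f) = Comp D (FG X) (FG Y) (FG Z) (K Y Z g) (K X Y f)"
    if o: "X \<in> Obj D" "Y \<in> Obj D" "Z \<in> Obj D" and f: "f \<in> Hom D X Y" and g: "g \<in> Hom D Y Z"
    for X Y Z f g
  proof (rule cancel[OF o(3) FGD[OF o(1)]])
    note gf = cod.comp_in[OF o f g]
    note FGo = FGD[OF o(1)] FGD[OF o(2)] FGD[OF o(3)]
    note Kf = K_in[OF o(1,2) f] and Kg = K_in[OF o(2,3) g]
    show "K X Z (Comp D X Y Z g f) \<in> Hom D (FG X) (FG Z)"
      using K_in[OF o(1,3) gf] .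
    show "Comp D (FG X) (FG Y) (FG Z) (K Y Z g) (K X Y f) \<in> Hom D (FG X) (FG Z)"
      using cod.comp_in[OF FGo Kf Kg] .
    have "Comp D (FG X) (FG Z) Z (\<epsilon> Z) (K X Z (Comp D X Y Z g f)) =
        Comp D (FG X) X Z (Comp D X Y Z g f) (\<epsilon> X)"
      using \<epsilon>_K[OF o(1,3) gf] .
    also have "\<dots> = Comp D (FG X) Y Z g (Comp D (FG X) X Y f (\<epsilon> X))"
      using cod.comp_assoc[OF FGo(1) o \<epsilon>[OF o(1)] f g] .
    also have "\<dots> = Comp D (FG X) Y Z g (Comp D (FG X) (FG Y) Y (\<epsilon> Y) (K X Y f))"
      using \<epsilon>_K[OF o(1,2) f] by simp
    also have "\<dots> = Comp D (FG X) (FG Y) Z (Comp D (FG Y) Y Z g (\<epsilon> Y)) (K X Y f)"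
      using cod.comp_assoc[OF FGo(1,2) o(2,3) Kf \<epsilon>[OF o(2)] g] by simp
    also have "\<dots> = Comp D (FG X) (FG Y) Z (Comp D (FG Y) (FG Z) Z (\<epsilon> Z) (K Y Z g)) (K X Y f)"
      using \<epsilon>_K[OF o(2,3) g] by simp
    also have "\<dots> = Comp D (FG X) (FG Z) Z (\<epsilon> Z) (Comp D (FG X) (FG Y) (FG Z) (K Y Z g) (K X Y f))"
      using cod.comp_assoc[OF FGo o(3) Kf Kg \<epsilon>[OF o(3)]] .
    finally show "Comp D (FG X) (FG Z) Z (\<epsilon> Z) (K X Z (Comp D X Y Z g f)) =
        Comp D (FG X) (FG Z) Z (\<epsilon> Z) (Comp D (FG X) (FG Y) (FG Z) (K Y Z g) (K X Y f))" .
  qed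

  have "cat_functor D C G"
  proof (unfold_locales)
    fix Y assume Y: "Y \<in> Obj D"
    show "on_obj G Y \<in> Obj C" using GC[OF Y] by (simp add: G_def)
    have "on_hom G Y Y (Ident D Y) = Ident C (G0 Y)"
      by (rule faithful[OF GC[OF Y] GC[OF Y]])
        (simp_all add: FG_hom[OF Y Y] G_in[OF Y Y] cod.ident_in[OF Y] dom.ident_in[OF GC[OF Y]]
          on_hom_ident[OF GC[OF Y]] K_ident[OF Y] flip: FG_def)
    then show "on_hom G Y Y (Ident D Y) = Ident C (on_obj G Y)" by (simp add: G_def)
  next
    fix X Y g assume "X \<in> Obj D" "Y \<in> Obj D" "g \<in> Hom D X Y"
    then show "on_hom G X Y g \<in> Hom C (on_obj G X) (on_obj G Y)"
      using G_in by (simp add: G_def)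
  next
    fix X Y Z f g
    assume o: "X \<in> Obj D" "Y \<in> Obj D" "Z \<in> Obj D" and f: "f \<in> Hom D X Y" and g: "g \<in> Hom D Y Z"
    note gf = cod.comp_in[OF o f g]
    note Go = GC[OF o(1)] GC[OF o(2)] GC[OF o(3)]
    note Gf = G_in[OF o(1,2) f] and Gg = G_in[OF o(2,3) g]
    have "on_hom G X Z (Comp D X Y Z g f) =
        Comp C (G0 X) (G0 Y) (G0 Z) (on_hom G Y Z g) (on_hom G X Y f)"
      by (rule faithful[OF Go(1,3) G_in[OF o(1,3) gf] dom.comp_in[OF Go Gf Gg]])
        (simp add: FG_hom o f g gf K_comp[OF o f g] on_hom_comp[OF Go Gf Gg] FG_def)
    then show "on_hom G X Z (Comp D X Y Z g f) =
        Comp C (on_obj G X) (on_obj G Y) (on_obj G Z) (on_hom G Y Z g) (on_hom G X Y f)"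
      by (simp add: G_def)
  qed
  moreover have "naturally_isomorphic D D (comp_functor F G) id_functor"
    unfolding naturally_isomorphic_def
  proof (intro exI[of _ \<epsilon>] conjI ballI)
    fix Y assume "Y \<in> Obj D"
    then show "\<epsilon> Y \<in> isos D (on_obj (comp_functor F G) Y) (on_obj id_functor Y)"
      using \<epsilon>_iso by (simp add: comp_functor_def id_functor_def G_def FG_def)
  next
    fix X Y f assume "X \<in> Obj D" "Y \<in> Obj D" "f \<in> Hom D X Y"
    then show "Comp D (on_obj (comp_functor F G) X) (on_obj (comp_functor F G) Y)
        (on_obj id_functor Y) (\<epsilon> Y) (on_hom (comp_functor F G) X Y f) =
      Comp D (on_obj (comp_functor F G) X) (on_obj id_functor X) (on_obj id_functor Y)
        (on_hom id_functor X Y f) (\<epsilon> X)"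
      using \<epsilon>_K FG_hom by (simp add: comp_functor_def id_functor_def G_def FG_def)
  qed
  moreover have "naturally_isomorphic C C (comp_functor G F) id_functor"
    unfolding naturally_isomorphic_def
  \<comment> \<open>the component at \<open>X\<close> is the lift of \<open>\<epsilon> (F X) : F (G (F X)) \<rightarrow> F X\<close>\<close>
  proof (intro exI[of _ "\<lambda>X. lift (G0 (on_obj F X)) X (\<epsilon> (on_obj F X))"] conjI ballI)
    fix X assume X: "X \<in> Obj C"
    then show "lift (G0 (on_obj F X)) X (\<epsilon> (on_obj F X))
        \<in> isos C (on_obj (comp_functor G F) X) (on_obj id_functor X)"
      using lift_isos[OF GC[OF on_obj_in[OF X]] X] \<epsilon>_iso[OF on_obj_in[OF X]]
      by (simp add: comp_functor_def id_functor_def G_def FG_def)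
  next
    fix X Y f assume X: "X \<in> Obj C" and Y: "Y \<in> Obj C" and f: "f \<in> Hom C X Y"
    define FX FY where "FX = on_obj F X" and "FY = on_obj F Y"
    have FX: "FX \<in> Obj D" and FY: "FY \<in> Obj D" and Ff: "on_hom F X Y f \<in> Hom D FX FY"
      using on_obj_in X Y on_hom_in f by (simp_all add: FX_def FY_def)
    note GX = GC[OF FX] and GY = GC[OF FY]
    define eX eY where "eX = lift (G0 FX) X (\<epsilon> FX)" and "eY = lift (G0 FY) Y (\<epsilon> FY)"
    have eX: "eX \<in> Hom C (G0 FX) X" "on_hom F (G0 FX) X eX = \<epsilon> FX"
      using lift_in[OF GX X] on_hom_lift[OF GX X] \<epsilon>[OF FX] by (simp_all add: eX_def FG_def FX_def)
    have eY: "eY \<in> Hom C (G0 FY) Y" "on_hom F (G0 FY) Y eY = \<epsilon> FY"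
      using lift_in[OF GY Y] on_hom_lift[OF GY Y] \<epsilon>[OF FY] by (simp_all add: eY_def FG_def FY_def)
    note Gf = G_in[OF FX FY Ff]
    have "on_hom F (G0 FX) Y (Comp C (G0 FX) (G0 FY) Y eY (on_hom G FX FY (on_hom F X Y f))) =
        Comp D (FG FX) (FG FY) FY (\<epsilon> FY) (K FX FY (on_hom F X Y f))"
      using on_hom_comp[OF GX GY Y Gf eY(1)] FG_hom[OF FX FY Ff] eY(2) by (simp add: FG_def FY_def)
    also have "\<dots> = Comp D (FG FX) FX FY (on_hom F X Y f) (\<epsilon> FX)"
      using \<epsilon>_K[OF FX FY Ff] .
    also have "\<dots> = on_hom F (G0 FX) Y (Comp C (G0 FX) X Y f eX)"
      using on_hom_comp[OF GX X Y eX(1) f] eX(2) by (simp add: FG_def FX_def FY_def)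
    finally have "Comp C (G0 FX) (G0 FY) Y eY (on_hom G FX FY (on_hom F X Y f)) =
        Comp C (G0 FX) X Y f eX"
      using faithful[OF GX Y] dom.comp_in[OF GX GY Y Gf eY(1)] dom.comp_in[OF GX X Y eX(1) f]
      by blast
    then show "Comp C (on_obj (comp_functor G F) X) (on_obj (comp_functor G F) Y)
        (on_obj id_functor Y) (lift (G0 (on_obj F Y)) Y (\<epsilon> (on_obj F Y)))
        (on_hom (comp_functor G F) X Y f) =
      Comp C (on_obj (comp_functor G F) X) (on_obj id_functor X) (on_obj id_functor Y)
        (on_hom id_functor X Y f) (lift (G0 (on_obj F X)) X (\<epsilon> (on_obj F X)))"
      by (simp add: comp_functor_def id_functor_def G_def eX_def eY_def FX_def FY_def)
  qed
  ultimately show ?thesis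
    unfolding equivalent_categories_def using cat_functor_axioms by blast
qed

end

section \<open>Transport of quantales along injections\<close>

text \<open>
The quantale structure that makes \<open>\<phi>\<close>, injective on the carrier, an isomorphism onto its image.
\<close>

definition transport :: "('a \<Rightarrow> 'b) \<Rightarrow> 'a quantale \<Rightarrow> 'b quantale" where
  "transport \<phi> Q = \<lparr>carrier = \<phi> ` carrier Q, eq = (=),
     le = (\<lambda>x y. inv_into (carrier Q) \<phi> x \<sqsubseteq>\<^bsub>Q\<^esub> inv_into (carrier Q) \<phi> y),
     qmult = (\<lambda>x y. \<phi> (qmult Q (inv_into (carrier Q) \<phi> x) (inv_into (carrier Q) \<phi> y)))\<rparr>"

lemma carrier_transport [simp]: "carrier (transport \<phi> Q) = \<phi> ` carrier Q"
  by (simp add: transport_def)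

context
  fixes Q :: "'a quantale" and \<phi> :: "'a \<Rightarrow> 'b"
  assumes Q: "comm_quantale Q" and inj: "inj_on \<phi> (carrier Q)"
begin

interpretation comm_quantale Q by (fact Q)

lemma le_transport:
  "\<lbrakk>x \<in> carrier Q; y \<in> carrier Q\<rbrakk> \<Longrightarrow> \<phi> x \<sqsubseteq>\<^bsub>transport \<phi> Q\<^esub> \<phi> y \<longleftrightarrow> x \<sqsubseteq>\<^bsub>Q\<^esub> y"
  and qmult_transport:
  "\<lbrakk>x \<in> carrier Q; y \<in> carrier Q\<rbrakk> \<Longrightarrow> qmult (transport \<phi> Q) (\<phi> x) (\<phi> y) = \<phi> (qmult Q x y)"
  by (simp_all add: transport_def inj)

lemma least_transport:
  assumes A: "A \<subseteq> carrier Q"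
  shows "least (transport \<phi> Q) (\<phi> (\<Squnion>\<^bsub>Q\<^esub>A)) (Upper (transport \<phi> Q) (\<phi> ` A))"
proof (rule least_UpperI)
  fix y assume "y \<in> \<phi> ` A"
  then show "y \<sqsubseteq>\<^bsub>transport \<phi> Q\<^esub> \<phi> (\<Squnion>\<^bsub>Q\<^esub>A)"
    using A by (auto simp: le_transport sup_closed sup_upper subsetD)
next
  fix y assume "y \<in> Upper (transport \<phi> Q) (\<phi> ` A)"
  then obtain x where x: "x \<in> carrier Q" "y = \<phi> x" "\<And>a. a \<in> A \<Longrightarrow> \<phi> a \<sqsubseteq>\<^bsub>transport \<phi> Q\<^esub> \<phi> x"
    using A by (auto simp: Upper_def)
  then show "\<phi> (\<Squnion>\<^bsub>Q\<^esub>A) \<sqsubseteq>\<^bsub>transport \<phi> Q\<^esub> y"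
    using A by (auto simp: le_transport sup_closed subsetD intro!: sup_least)
qed (use A sup_closed in auto)

lemma suplattice_transport: "suplattice (transport \<phi> Q)"
proof (unfold_locales)
  fix x y z
  assume "x \<in> carrier (transport \<phi> Q)" "y \<in> carrier (transport \<phi> Q)" "z \<in> carrier (transport \<phi> Q)"
    and "x \<sqsubseteq>\<^bsub>transport \<phi> Q\<^esub> y" "y \<sqsubseteq>\<^bsub>transport \<phi> Q\<^esub> z"
  then show "x \<sqsubseteq>\<^bsub>transport \<phi> Q\<^esub> z"
    by (auto simp: le_transport intro: le_trans)
next
  fix A assume "A \<subseteq> carrier (transport \<phi> Q)"
  then obtain B where "B \<subseteq> carrier Q" "A = \<phi> ` B"
    by (metis carrier_transport subset_imageE)
  then show "\<exists>s. least (transport \<phi> Q) s (Upper (transport \<phi> Q) A)"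
    using least_transport by blast
next
  fix x y
  assume "x \<in> carrier (transport \<phi> Q)" "y \<in> carrier (transport \<phi> Q)"
    "x \<sqsubseteq>\<^bsub>transport \<phi> Q\<^esub> y" "y \<sqsubseteq>\<^bsub>transport \<phi> Q\<^esub> x"
  then have "x = y" by (auto simp: le_transport dest: le_antisym)
  then show "x .=\<^bsub>transport \<phi> Q\<^esub> y" by (simp add: transport_def)
next
  fix x assume "x \<in> carrier (transport \<phi> Q)"
  then show "x \<sqsubseteq>\<^bsub>transport \<phi> Q\<^esub> x" by (auto simp: le_transport)
qed (simp_all add: transport_def)

lemma sup_transport: "A \<subseteq> carrier Q \<Longrightarrow> \<Squnion>\<^bsub>transport \<phi> Q\<^esub>(\<phi> ` A) = \<phi> (\<Squnion>\<^bsub>Q\<^esub>A)"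
  by (rule suplattice.sup_eqI[OF suplattice_transport _ least_transport]) auto

lemma comm_quantale_transport: "comm_quantale (transport \<phi> Q)"
proof -
  have dist: "qmult (transport \<phi> Q) (\<Squnion>\<^bsub>transport \<phi> Q\<^esub>A) y =
        \<Squnion>\<^bsub>transport \<phi> Q\<^esub>((\<lambda>x. qmult (transport \<phi> Q) x y) ` A)"
      "qmult (transport \<phi> Q) y (\<Squnion>\<^bsub>transport \<phi> Q\<^esub>A) =
        \<Squnion>\<^bsub>transport \<phi> Q\<^esub>((\<lambda>x. qmult (transport \<phi> Q) y x) ` A)"
    if A: "A \<subseteq> carrier (transport \<phi> Q)" and y: "y \<in> carrier (transport \<phi> Q)" for A y
  proof -
    obtain B where B: "B \<subseteq> carrier Q" "A = \<phi> ` B"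
      using A by (auto simp: subset_image_iff)
    obtain z where z: "z \<in> carrier Q" "y = \<phi> z"
      using y by auto
    have im: "(\<lambda>x. qmult (transport \<phi> Q) x y) ` A = \<phi> ` (\<lambda>x. qmult Q x z) ` B"
        "(\<lambda>x. qmult (transport \<phi> Q) y x) ` A = \<phi> ` (\<lambda>x. qmult Q z x) ` B"
      unfolding B(2) z(2) image_image using B(1) z(1)
      by (auto intro!: image_cong simp: qmult_transport subsetD)
    have sub: "(\<lambda>x. qmult Q x z) ` B \<subseteq> carrier Q" "(\<lambda>x. qmult Q z x) ` B \<subseteq> carrier Q"
      using B(1) z(1) qmult_closed by auto
    show "qmult (transport \<phi> Q) (\<Squnion>\<^bsub>transport \<phi> Q\<^esub>A) y =
        \<Squnion>\<^bsub>transport \<phi> Q\<^esub>((\<lambda>x. qmult (transport \<phi> Q) x y) ` A)"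
      unfolding im(1) sup_transport[OF sub(1)] unfolding B(2) z(2)
      using B(1) z(1) by (simp add: sup_transport qmult_transport sup_closed qmult_sup_left)
    show "qmult (transport \<phi> Q) y (\<Squnion>\<^bsub>transport \<phi> Q\<^esub>A) =
        \<Squnion>\<^bsub>transport \<phi> Q\<^esub>((\<lambda>x. qmult (transport \<phi> Q) y x) ` A)"
      unfolding im(2) sup_transport[OF sub(2)] unfolding B(2) z(2)
      using B(1) z(1) by (simp add: sup_transport qmult_transport sup_closed qmult_sup_right)
  qed
  show ?thesis
    by (intro comm_quantale.intro comm_quantale_axioms.intro suplattice_transport)
      (auto simp: qmult_transport qmult_closed qmult_assoc dist
        intro!: arg_cong[of _ _ \<phi>] intro: qmult_comm)
qed

lemma transport_map: "(\<lambda>x\<in>carrier Q. \<phi> x) \<in> quantale_maps Q (transport \<phi> Q)"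
proof -
  have "(\<lambda>x\<in>carrier Q. \<phi> x) ` A = \<phi> ` A" if "A \<subseteq> carrier Q" for A
    using that by force
  then show ?thesis
    by (auto simp: quantale_maps_def sup_transport sup_closed qmult_transport qmult_closed)
qed

lemma transport_bij: "bij_betw (\<lambda>x\<in>carrier Q. \<phi> x) (carrier Q) (carrier (transport \<phi> Q))"
  using inj by (simp add: bij_betw_restrict_eq inj_on_imp_bij_betw)

lemma quantale_isomorphic_transport: "quantale_isomorphic Q (transport \<phi> Q)"
  using quantale_isomorphicI[OF Q comm_quantale_transport transport_map transport_bij] .

lemma transport_map_inverse:
  "(\<lambda>y\<in>\<phi> ` carrier Q. inv_into (carrier Q) \<phi> y) \<in> quantale_maps (transport \<phi> Q) Q"
proof -
  have "inv_into (carrier Q) (\<lambda>x\<in>carrier Q. \<phi> x) (\<phi> x) = x" if "x \<in> carrier Q" for x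
    using transport_bij that by (metis bij_betw_inv_into_left restrict_apply')
  then have "(\<lambda>y\<in>\<phi> ` carrier Q. inv_into (carrier Q) \<phi> y) =
      (\<lambda>y\<in>carrier (transport \<phi> Q). inv_into (carrier Q) (\<lambda>x\<in>carrier Q. \<phi> x) y)"
    using inj by (auto intro!: restrict_ext)
  then show ?thesis
    using quantale_maps_inverse[OF Q comm_quantale_transport transport_map transport_bij] by simp
qed

end

definition transport_hom ::
  "('a \<Rightarrow> 'b) \<Rightarrow> ('c \<Rightarrow> 'd) \<Rightarrow> 'a quantale \<Rightarrow> ('a \<Rightarrow> 'c) \<Rightarrow> 'b \<Rightarrow> 'd" where
  "transport_hom \<phi> \<psi> Q h = (\<lambda>y\<in>\<phi> ` carrier Q. \<psi> (h (inv_into (carrier Q) \<phi> y)))"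

lemma transport_hom_apply:
  "\<lbrakk>inj_on \<phi> (carrier Q); x \<in> carrier Q\<rbrakk> \<Longrightarrow> transport_hom \<phi> \<psi> Q h (\<phi> x) = \<psi> (h x)"
  by (simp add: transport_hom_def)

lemma transport_hom_in:
  assumes Q: "comm_quantale Q" "inj_on \<phi> (carrier Q)"
    and R: "comm_quantale R" "inj_on \<psi> (carrier R)"
    and h: "h \<in> quantale_maps Q R"
  shows "transport_hom \<phi> \<psi> Q h \<in> quantale_maps (transport \<phi> Q) (transport \<psi> R)"
proof -
  have "transport_hom \<phi> \<psi> Q h =
      compose (carrier (transport \<phi> Q)) (compose (carrier Q) (\<lambda>x\<in>carrier R. \<psi> x) h)
        (\<lambda>y\<in>\<phi> ` carrier Q. inv_into (carrier Q) \<phi> y)"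
    using quantale_mapsD(2)[OF h] Q(2)
    by (auto simp: transport_hom_def compose_def intro!: restrict_ext)
  then show ?thesis
    using quantale_maps_comp[OF comm_quantale_transport[OF Q] transport_map_inverse[OF Q]
        quantale_maps_comp[OF Q(1) h transport_map[OF R]]] by simp
qed

lemma transport_hom_bij:
  assumes Q: "comm_quantale Q" "inj_on \<phi> (carrier Q)"
    and R: "comm_quantale R" "inj_on \<psi> (carrier R)"
  shows "bij_betw (transport_hom \<phi> \<psi> Q) (quantale_maps Q R)
    (quantale_maps (transport \<phi> Q) (transport \<psi> R))"
proof -
  let ?untransport = "\<lambda>g. \<lambda>x\<in>carrier Q. inv_into (carrier R) \<psi> (g (\<phi> x))"
  show ?thesis
  proof (rule bij_betwI)
    show "transport_hom \<phi> \<psi> Q \<in> quantale_maps Q R \<rightarrow> quantale_maps (transport \<phi> Q) (transport \<psi> R)"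
      using transport_hom_in[OF assms] by blast
    show "?untransport \<in> quantale_maps (transport \<phi> Q) (transport \<psi> R) \<rightarrow> quantale_maps Q R"
    proof
      fix g assume g: "g \<in> quantale_maps (transport \<phi> Q) (transport \<psi> R)"
      have "?untransport g = compose (carrier Q)
          (compose (carrier (transport \<phi> Q)) (\<lambda>y\<in>\<psi> ` carrier R. inv_into (carrier R) \<psi> y) g)
          (\<lambda>x\<in>carrier Q. \<phi> x)"
        by (rule extensionalityI[of _ "carrier Q"])
          (use quantale_mapsD(2)[OF g] in \<open>simp_all add: compose_eq\<close>)
      then show "?untransport g \<in> quantale_maps Q R"
        using quantale_maps_comp[OF Q(1) transport_map[OF Q]
            quantale_maps_comp[OF comm_quantale_transport[OF Q] g transport_map_inverse[OF R]]]
        by simp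
    qed
  next
    fix h assume h: "h \<in> quantale_maps Q R"
    show "?untransport (transport_hom \<phi> \<psi> Q h) = h"
      by (rule extensionalityI[of _ "carrier Q"])
        (use quantale_mapsD(1,2)[OF h] Q(2) R(2) in \<open>simp_all add: transport_hom_apply PiE_iff\<close>)
  next
    fix g assume g: "g \<in> quantale_maps (transport \<phi> Q) (transport \<psi> R)"
    have "\<psi> (inv_into (carrier R) \<psi> (g y)) = g y" if "y \<in> \<phi> ` carrier Q" for y
      using quantale_mapsD(2)[OF g, of y] that by (simp add: f_inv_into_f)
    then show "transport_hom \<phi> \<psi> Q (?untransport g) = g"
      by (intro extensionalityI[of _ "\<phi> ` carrier Q"])
        (use quantale_mapsD(1)[OF g] Q(2) in \<open>auto simp: transport_hom_def PiE_iff\<close>)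
  qed
qed

text \<open>
The functor \<open>F\<close> followed, at each object, by the isomorphism of its value with a copy on another
  type. Full faithfulness survives, because hom-sets change only by conjugation.
\<close>

definition transport_functor ::
  "('o \<Rightarrow> 'a \<Rightarrow> 'b) \<Rightarrow> ('o, 'm, 'a quantale, 'a \<Rightarrow> 'a) prefunctor \<Rightarrow>
   ('o, 'm, 'b quantale, 'b \<Rightarrow> 'b) prefunctor"
  where
  "transport_functor \<phi> F = \<lparr>on_obj = (\<lambda>X. transport (\<phi> X) (on_obj F X)),
     on_hom = (\<lambda>X Y f. transport_hom (\<phi> X) (\<phi> Y) (on_obj F X) (on_hom F X Y f))\<rparr>"

lemma fully_faithful_transport_functor:
  assumes F: "fully_faithful_functor C (cQu \<T>) F"
    and inj: "\<And>X. X \<in> Obj C \<Longrightarrow> inj_on (\<phi> X) (carrier (on_obj F X))"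
    and mem: "\<And>X. X \<in> Obj C \<Longrightarrow> \<phi> X ` carrier (on_obj F X) \<in> \<S>"
  shows "fully_faithful_functor C (cQu \<S>) (transport_functor \<phi> F)"
proof -
  interpret F: fully_faithful_functor C "cQu \<T>" F by fact
  have Q: "comm_quantale (on_obj F X)" if "X \<in> Obj C" for X
    using F.on_obj_in[OF that] by (simp add: cQu_def)
  have hom: "on_hom F X Y f \<in> quantale_maps (on_obj F X) (on_obj F Y)"
    if "X \<in> Obj C" "Y \<in> Obj C" "f \<in> Hom C X Y" for X Y f
    using F.on_hom_in[OF that] by (simp add: cQu_def)
  show ?thesis
  proof (intro fully_faithful_functor.intro fully_faithful_functor_axioms.intro cat_functor.intro
      cat_functor_axioms.intro category_cQu F.dom.category_axioms)
    fix X assume X: "X \<in> Obj C"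
    show "on_obj (transport_functor \<phi> F) X \<in> Obj (cQu \<S>)"
      using mem[OF X] comm_quantale_transport[OF Q[OF X] inj[OF X]]
      by (simp add: transport_functor_def cQu_def)
    have "on_hom F X X (Ident C X) = (\<lambda>x\<in>carrier (on_obj F X). x)"
      using F.on_hom_ident[OF X] by (simp add: cQu_def)
    then have "transport_hom (\<phi> X) (\<phi> X) (on_obj F X) (on_hom F X X (Ident C X)) =
        (\<lambda>y\<in>\<phi> X ` carrier (on_obj F X). y)"
      unfolding transport_hom_def using inj[OF X] by (intro restrict_ext) auto
    then show "on_hom (transport_functor \<phi> F) X X (Ident C X) =
        Ident (cQu \<S>) (on_obj (transport_functor \<phi> F) X)"
      by (simp add: transport_functor_def cQu_def)
  next
    fix X Y f assume o: "X \<in> Obj C" "Y \<in> Obj C" and f: "f \<in> Hom C X Y"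
    show "on_hom (transport_functor \<phi> F) X Y f
        \<in> Hom (cQu \<S>) (on_obj (transport_functor \<phi> F) X) (on_obj (transport_functor \<phi> F) Y)"
      using transport_hom_in[OF Q[OF o(1)] inj[OF o(1)] Q[OF o(2)] inj[OF o(2)] hom[OF o f]]
      by (simp add: transport_functor_def cQu_def)
  next
    fix X Y Z f g
    assume o: "X \<in> Obj C" "Y \<in> Obj C" "Z \<in> Obj C" and f: "f \<in> Hom C X Y" and g: "g \<in> Hom C Y Z"
    let ?f = "on_hom F X Y f" and ?g = "on_hom F Y Z g"
    have fx: "?f x \<in> carrier (on_obj F Y)" if "x \<in> carrier (on_obj F X)" for x
      using quantale_mapsD(2)[OF hom[OF o(1,2) f] that] .
    have "on_hom F X Z (Comp C X Y Z g f) = compose (carrier (on_obj F X)) ?g ?f"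
      using F.on_hom_comp[OF o f g] by (simp add: cQu_def)
    then have "transport_hom (\<phi> X) (\<phi> Z) (on_obj F X) (on_hom F X Z (Comp C X Y Z g f)) =
        compose (\<phi> X ` carrier (on_obj F X)) (transport_hom (\<phi> Y) (\<phi> Z) (on_obj F Y) ?g)
          (transport_hom (\<phi> X) (\<phi> Y) (on_obj F X) ?f)"
      unfolding compose_def using fx
      by (intro extensionalityI[of _ "\<phi> X ` carrier (on_obj F X)"])
        (auto simp: transport_hom_apply[OF inj[OF o(1)]] transport_hom_apply[OF inj[OF o(2)]],
          auto simp: transport_hom_def)
    then show "on_hom (transport_functor \<phi> F) X Z (Comp C X Y Z g f) =
        Comp (cQu \<S>) (on_obj (transport_functor \<phi> F) X) (on_obj (transport_functor \<phi> F) Y)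
          (on_obj (transport_functor \<phi> F) Z) (on_hom (transport_functor \<phi> F) Y Z g)
          (on_hom (transport_functor \<phi> F) X Y f)"
      by (simp add: transport_functor_def cQu_def)
  next
    have "bij_betw (on_hom (transport_functor \<phi> F) X Y) (Hom C X Y)
        (Hom (cQu \<S>) (on_obj (transport_functor \<phi> F) X) (on_obj (transport_functor \<phi> F) Y))"
      if o: "X \<in> Obj C" "Y \<in> Obj C" for X Y
    proof -
      have "bij_betw (on_hom F X Y) (Hom C X Y) (quantale_maps (on_obj F X) (on_obj F Y))"
        using F.bij_on_hom[OF o] by (simp add: cQu_def)
      from bij_betw_trans[OF this
          transport_hom_bij[OF Q[OF o(1)] inj[OF o(1)] Q[OF o(2)] inj[OF o(2)]]]
      show ?thesis by (simp add: transport_functor_def cQu_def comp_def)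
    qed
    then show "full_and_faithful C (cQu \<S>) (transport_functor \<phi> F)"
      by (simp add: full_and_faithful_def)
  qed
qed

section \<open>The duality\<close>

text \<open>
The saturated sets of \<open>X\<close> are subsets of its carrier, so an injection of the powerset of the
  carrier into a member of \<open>\<S>\<close> moves \<open>Sat X\<close> into a set of \<open>\<S>\<close>. The cover presenting a quantale
  has the same carrier, so no change of size occurs in the direction that shows essential
  surjectivity.
\<close>

theorem CBCov_dual_cQu:
  fixes \<S> :: "'u set set"
  assumes \<S>: "impredicative_universe \<S>"
  shows "equivalent_categories (opposite (CBCov \<S>)) (cQu \<S>)"
proof -
  obtain \<phi> :: "'u set \<Rightarrow> 'u set \<Rightarrow> 'u"
    where inj: "\<And>S. S \<in> \<S> \<Longrightarrow> inj_on (\<phi> S) (Pow S)" and mem: "\<And>S. S \<in> \<S> \<Longrightarrow> \<phi> S ` Pow S \<in> \<S>"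
  proof -
    have "\<exists>f. inj_on f (Pow S) \<and> f ` Pow S \<in> \<S>" if S: "S \<in> \<S>" for S
    proof -
      obtain P where P: "P \<in> \<S>" "Pow S \<approx> P"
        using \<S> S by (auto simp: impredicative_universe_def)
      then obtain f where "bij_betw f (Pow S) P" unfolding eqpoll_def by (elim conjE exE)
      with P(1) show ?thesis by (intro exI[of _ f]) (simp add: bij_betw_def)
    qed
    then have "\<forall>S\<in>\<S>. \<exists>f. inj_on f (Pow S) \<and> f ` Pow S \<in> \<S>" by (rule ballI)
    then obtain f where "\<forall>S\<in>\<S>. inj_on (f S) (Pow S) \<and> f S ` Pow S \<in> \<S>"
      by (rule exE[OF bchoice])
    then show ?thesis by (intro that[of f]) simp_all
  qed
  let ?F = "transport_functor (\<lambda>X. \<phi> (carrier X)) sat_functor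
    :: ('u conv_cover, 'u rel set, 'u quantale, 'u \<Rightarrow> 'u) prefunctor"
  have sat: "fully_faithful_functor (opposite (CBCov \<S>)) (cQu UNIV) sat_functor"
    by (intro fully_faithful_functor.intro fully_faithful_functor_axioms.intro
        cat_functor_sat_functor full_and_faithful_sat_functor)
  have carrier: "carrier (on_obj sat_functor X) \<subseteq> Pow (carrier X)" for X :: "'u conv_cover"
    by (auto simp: sat_functor_def Sat_def)
  interpret F: fully_faithful_functor "opposite (CBCov \<S>)" "cQu \<S>" ?F
  proof (rule fully_faithful_transport_functor[OF sat])
    fix X assume "X \<in> Obj (opposite (CBCov \<S>))"
    then have X: "carrier X \<in> \<S>" by (simp add: Obj_CBCov)
    show "inj_on (\<phi> (carrier X)) (carrier (on_obj sat_functor X))"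
      using inj[OF X] carrier by (rule inj_on_subset)
    have "\<phi> (carrier X) ` carrier (on_obj sat_functor X) \<subseteq> \<phi> (carrier X) ` Pow (carrier X)"
      using carrier by (rule image_mono)
    then show "\<phi> (carrier X) ` carrier (on_obj sat_functor X) \<in> \<S>"
      using mem[OF X] \<S> unfolding impredicative_universe_def by blast
  qed
  show ?thesis
  proof (rule F.equivalence_if_essentially_surjective)
    fix Q assume QO: "Q \<in> Obj (cQu \<S>)"
    then have Q: "comm_quantale Q" and "carrier Q \<in> \<S>" by (simp_all add: cQu_def)
    let ?X = "quantale_cover Q"
    note conv = convergent_cover_quantale_cover[OF Q]
    have X: "?X \<in> Obj (opposite (CBCov \<S>))"
      using conv \<open>carrier Q \<in> \<S>\<close> by (simp add: Obj_CBCov)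
    have inj': "inj_on (\<phi> (carrier ?X)) (carrier (sat_quantale ?X))"
      using inj[of "carrier ?X"] \<open>carrier Q \<in> \<S>\<close> carrier[of ?X]
      by (auto simp: sat_functor_def intro: inj_on_subset)
    have "quantale_isomorphic (on_obj ?F ?X) (sat_quantale ?X)"
      using quantale_isomorphic_sym[OF
          quantale_isomorphic_transport[OF comm_quantale_sat_quantale[OF conv] inj']]
      by (simp add: transport_functor_def sat_functor_def)
    moreover have "comm_quantale (on_obj ?F ?X)"
      using F.on_obj_in[OF X] by (simp add: cQu_def)
    ultimately have "quantale_isomorphic (on_obj ?F ?X) Q"
      using quantale_isomorphic_trans Q
        quantale_isomorphic_sym[OF quantale_isomorphic_sat_quantale_cover[OF Q]] by blast
    then have "isos (cQu \<S>) (on_obj ?F ?X) Q \<noteq> {}"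
      by (rule isos_cQu_nonempty[OF F.on_obj_in[OF X] QO])
    with X show "\<exists>X\<in>Obj (opposite (CBCov \<S>)). isos (cQu \<S>) (on_obj ?F X) Q \<noteq> {}" by blast
  qed
qed

theorem proposition4p8:
  fixes \<S> :: "'u set set"
  shows "subcategory_along basic_cover.truncate (CBCov \<S>) (BCov \<S>) \<and>
    (impredicative_universe \<S> \<longrightarrow> equivalent_categories (opposite (CBCov \<S>)) (cQu \<S>)) \<and>
    (cat_functor (opposite (CBCov (UNIV :: 'u set set))) (cQu (UNIV :: 'u set set set)) sat_functor \<and>
     full_and_faithful (opposite (CBCov (UNIV :: 'u set set))) (cQu (UNIV :: 'u set set set)) sat_functor \<and>
     (\<forall>Q :: 'u quantale. comm_quantale Q \<longrightarrow>
        (\<exists>X :: 'u conv_cover. convergent_cover X \<and> quantale_isomorphic Q (sat_quantale X))))"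
  using CBCov_subcategory CBCov_dual_cQu cat_functor_sat_functor full_and_faithful_sat_functor
    convergent_cover_quantale_cover quantale_isomorphic_sat_quantale_cover by blast

end
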